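(* Let $\mathfrak p=(\lambda,e_2)\in\mathcal L$, and let $\mu_{\mathfrak p}$ be the solution described in the context (here $c=0$). Define $$\Theta_{\mathfrak p}(s)=-\int_0^s\mu_{\mathfrak p}^2\left(\mu_{\mathfrak p}+2\lambda\right)ds .$$ Then $$\gamma_{\mathfrak p}=\frac{1}{2\sqrt2\,\mu_{\mathfrak p}}\left(2\Theta_{\mathfrak p}^2+2\mu_{\mathfrak p}^2+1,\ 2\sqrt2\,\Theta_{\mathfrak p},\ 2\Theta_{\mathfrak p}^2+2\mu_{\mathfrak p}^2-1\right)$$ is a BL-curve with modulus $\mathfrak p$ and momentum $\vec\xi=\frac1{\sqrt2}(1,0,1)$. Moreover, there are no BL-strings, i.e. no BL-curve is closed.
   Context: **Hyperbolic plane and curves.** $\mathbb{R}^{1,2}$ is $\mathbb{R}^3$ with the inner product $\vec x\cdot\vec y=-x^1y^1+x^2y^2+x^3y^3$ and the cross product defined by $(\vec x\times\vec y)\cdot\vec w=\det(\vec x,\vec y,\vec w)$. The hyperbolic plane is $\mathcal{H}^2=\{\vec x\in\mathbb{R}^{1,2}: \vec x\cdot\vec x=-1,\ x^1>0\}$ with the induced metric. For a curve $\gamma$ in $\mathcal{H}^2$ (smooth, immersed, on its maximal interval of definition) with arc length $s$, a dot denotes $d/ds$ and the geodesic curvature $\kappa$ is defined by $\ddot\gamma=\gamma+\kappa\,\gamma\times\dot\gamma$. A curve is convex if $\kappa$ never vanishes, and it is then oriented so that $\kappa>0$; its Blaschke invariant is $\mu=\sqrt\kappa$. A curve is closed if it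 is periodic. **B-curves.** Let $Q_{\lambda,c}(x)=x^4+4\lambda x^3+4(\lambda^2-c)x^2-1$. A B-curve is a convex curve whose Blaschke invariant $\mu$ is a non-constant periodic solution of $\dot\mu^2=-\mu^2Q_{\lambda,c}(\mu)$ for some $\lambda,c\in\mathbb{R}$; then $Q_{\lambda,c}$ has four distinct real roots $e_1>e_2>e_3>0>e_4$, and the pair $(\lambda,e_2)$ is called the modulus of the curve. The momentum of a B-curve is the constant vector $\vec\xi=\frac1{2\mu}\gamma+\frac{\dot\mu}{2\mu^2}\dot\gamma-(\lambda+\frac\mu2)\gamma\times\dot\gamma$, which satisfies $\vec\xi\cdot\vec\xi=c$. A BL-curve is a B-curve with light-like momentum (so $c=0$); a BL-string is a closed BL-curve. **Moduli.** $\mathfrak{P}=\{(\lambda,e_2)\in\mathbb{R}^2: e_2>0,\ e_2^4+2\lambda e_2^3+1<0\}$. For $(\lambda,e_2)\in\mathfrak P$ let $c(\lambda,e_2)$ be the unique $c$ with $Q_{\lambda,c}(e_2)=0$, namely $c=\lambda^2+\lambda e_2+\frac{e_2^2}{4}-\frac1{4e_2^2}$ (then $e_2$ is the second largest of the four distinct real roots $e_1>e_2>e_3>0>e_4$ of $Q_{\lambda,c}$). Set $\mathcal L=\{(\lambda,e_2)\in\mathfrak P: c(\lambda,e_2)=0\}$; equivalently, $\lambda<-1$ and $e_2=-\lambda+\sqrt{\lambda^2-1}$. For $\mathfrak p=(\lambda,e_2)\in\mathfrak P$, $\mu_{\mathfrak p}$ is the solution of $\ddot\mu=\frac{2\dot\mu^2}{\mu}-\mu-2\lambda\mu^4-\mu^5$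 with $\mu(0)=e_2$, $\dot\mu(0)=0$; it is positive, non-constant, periodic and satisfies $\dot\mu_{\mathfrak p}^2=-\mu_{\mathfrak p}^2Q_{\lambda,c}(\mu_{\mathfrak p})$. *)

theory Defs
  imports "HOL-Analysis.Analysis" "HOL-Library.Periodic_Fun"
begin

section \<open>Minkowski 3-space and the hyperbolic plane\<close>

definition lprod :: "real^3 \<Rightarrow> real^3 \<Rightarrow> real" (infix "\<bullet>\<^sub>L" 70)
  where "x \<bullet>\<^sub>L y = - (x$1 * y$1) + x$2 * y$2 + x$3 * y$3"

definition lcross :: "real^3 \<Rightarrow> real^3 \<Rightarrow> real^3" (infixl "\<times>\<^sub>L" 75)
  where "x \<times>\<^sub>L y = (THE z. \<forall>w. z \<bullet>\<^sub>L w = det (vector [x, y, w] :: real^3^3))"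

lemma lprod_det_iff:
  "(\<forall>w. z \<bullet>\<^sub>L w = det (vector [x, y, w] :: real^3^3)) \<longleftrightarrow>
   z = vector [x$3 * y$2 - x$2 * y$3, x$3 * y$1 - x$1 * y$3, x$1 * y$2 - x$2 * y$1]"
  (is "?L \<longleftrightarrow> z = ?c")
proof
  assume h: ?L
  show "z = ?c"
    using h[rule_format, of "axis 1 1"] h[rule_format, of "axis 2 1"] h[rule_format, of "axis 3 1"]
    by (simp add: vec_eq_iff forall_3 lprod_def det_3 axis_def)
next
  assume "z = ?c"
  then show ?L
    by (simp add: lprod_def det_3 algebra_simps)
qed

lemma lcross_eq:
  "x \<times>\<^sub>L y = vector [x$3 * y$2 - x$2 * y$3, x$3 * y$1 - x$1 * y$3, x$1 * y$2 - x$2 * y$1]"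
  unfolding lcross_def lprod_det_iff by simp

lemma lprod_lcross: "(x \<times>\<^sub>L y) \<bullet>\<^sub>L w = det (vector [x, y, w] :: real^3^3)"
  using lprod_det_iff lcross_eq by blast

definition light_like :: "real^3 \<Rightarrow> bool"
  where "light_like x \<longleftrightarrow> x \<noteq> 0 \<and> x \<bullet>\<^sub>L x = 0"

definition hyperbolic_plane :: "(real^3) set"
  where "hyperbolic_plane = {x. x \<bullet>\<^sub>L x = -1 \<and> x$1 > 0}"


section \<open>Curves\<close>

definition dot :: "(real \<Rightarrow> 'a::real_normed_vector) \<Rightarrow> real \<Rightarrow> 'a"
  where "dot f s = vector_derivative f (at s)"

definition smooth :: "(real \<Rightarrow> 'a::real_normed_vector) \<Rightarrow> bool"
  where "smooth f \<longleftrightarrow> (\<forall>n s. (dot ^^ n) f differentiable (at s))"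

definition periodic :: "(real \<Rightarrow> 'a) \<Rightarrow> bool"
  where "periodic f \<longleftrightarrow> (\<exists>T>0. periodic_fun_simple f T)"

text \<open>
  Curves are smooth, immersed and parametrized by arc length.  Only curves whose Blaschke invariant
  is periodic are considered below; their maximal interval of definition is the whole real line,
  which is therefore taken as the domain.
\<close>
definition hcurve :: "(real \<Rightarrow> real^3) \<Rightarrow> bool"
  where "hcurve \<gamma> \<longleftrightarrow>
    smooth \<gamma> \<and> (\<forall>s. \<gamma> s \<in> hyperbolic_plane \<and> dot \<gamma> s \<bullet>\<^sub>L dot \<gamma> s = 1)"

definition closed_curve :: "(real \<Rightarrow> real^3) \<Rightarrow> bool"
  where "closed_curve \<gamma> \<longleftrightarrow> periodic \<gamma>"

definition geodesic_curvature :: "(real \<Rightarrow> real^3) \<Rightarrow> real \<Rightarrow> real"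
  where "geodesic_curvature \<gamma> s =
    (THE \<kappa>. dot (dot \<gamma>) s = \<gamma> s + \<kappa> *\<^sub>R (\<gamma> s \<times>\<^sub>L dot \<gamma> s))"

text \<open>
  Reversing the orientation changes the sign of the geodesic curvature, so a curve whose curvature
  never vanishes has exactly one orientation with positive curvature.  It is the one used here.
\<close>
definition convex_curve :: "(real \<Rightarrow> real^3) \<Rightarrow> bool"
  where "convex_curve \<gamma> \<longleftrightarrow> hcurve \<gamma> \<and> (\<forall>s. geodesic_curvature \<gamma> s > 0)"

definition blaschke :: "(real \<Rightarrow> real^3) \<Rightarrow> real \<Rightarrow> real"
  where "blaschke \<gamma> s = sqrt (geodesic_curvature \<gamma> s)"


section \<open>B-curves\<close>

definition Q :: "real \<Rightarrow> real \<Rightarrow> real \<Rightarrow> real"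
  where "Q l c x = x^4 + 4 * l * x^3 + 4 * (l^2 - c) * x^2 - 1"

definition B_curve_with :: "real \<Rightarrow> real \<Rightarrow> (real \<Rightarrow> real^3) \<Rightarrow> bool"
  where "B_curve_with l c \<gamma> \<longleftrightarrow>
    convex_curve \<gamma> \<and>
    \<not> blaschke \<gamma> constant_on UNIV \<and>
    periodic (blaschke \<gamma>) \<and>
    (\<forall>s. blaschke \<gamma> differentiable (at s) \<and>
         (dot (blaschke \<gamma>) s)^2 = - ((blaschke \<gamma> s)^2 * Q l c (blaschke \<gamma> s)))"

definition B_curve :: "(real \<Rightarrow> real^3) \<Rightarrow> bool"
  where "B_curve \<gamma> \<longleftrightarrow> (\<exists>l c. B_curve_with l c \<gamma>)"

definition has_modulus :: "(real \<Rightarrow> real^3) \<Rightarrow> real \<times> real \<Rightarrow> bool"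
  where "has_modulus \<gamma> = (\<lambda>(l, e2). \<exists>c e1 e3 e4. B_curve_with l c \<gamma> \<and>
    e1 > e2 \<and> e2 > e3 \<and> e3 > 0 \<and> 0 > e4 \<and> {x. Q l c x = 0} = {e1, e2, e3, e4})"

text \<open>
  The parameters \<open>l\<close> and \<open>c\<close> are determined by the curve, since the polynomial \<open>Q l c\<close>
  is determined on the range of the non-constant Blaschke invariant.  The momentum is a constant
  vector: the defining expression takes the same value at every \<open>s\<close>.
\<close>
definition has_momentum :: "(real \<Rightarrow> real^3) \<Rightarrow> real^3 \<Rightarrow> bool"
  where "has_momentum \<gamma> \<xi> \<longleftrightarrow> (\<exists>l c. B_curve_with l c \<gamma> \<and>
    (\<forall>s. \<xi> = (1 / (2 * blaschke \<gamma> s)) *\<^sub>R \<gamma> s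
            + (dot (blaschke \<gamma>) s / (2 * (blaschke \<gamma> s)^2)) *\<^sub>R dot \<gamma> s
            - (l + blaschke \<gamma> s / 2) *\<^sub>R (\<gamma> s \<times>\<^sub>L dot \<gamma> s)))"

definition BL_curve :: "(real \<Rightarrow> real^3) \<Rightarrow> bool"
  where "BL_curve \<gamma> \<longleftrightarrow> B_curve \<gamma> \<and> (\<exists>\<xi>. has_momentum \<gamma> \<xi> \<and> light_like \<xi>)"

definition BL_string :: "(real \<Rightarrow> real^3) \<Rightarrow> bool"
  where "BL_string \<gamma> \<longleftrightarrow> BL_curve \<gamma> \<and> closed_curve \<gamma>"


section \<open>Moduli and the model curves\<close>

definition moduli :: "(real \<times> real) set"
  where "moduli = {(l, e2). e2 > 0 \<and> e2^4 + 2 * l * e2^3 + 1 < 0}"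

definition c_of :: "real \<times> real \<Rightarrow> real"
  where "c_of = (\<lambda>(l, e2). THE c. Q l c e2 = 0)"

lemma c_of_eq:
  assumes "e2 \<noteq> 0"
  shows "c_of (l, e2) = l^2 + l * e2 + e2^2 / 4 - 1 / (4 * e2^2)"
proof -
  have "Q l c e2 = 4 * e2^2 * ((l^2 + l * e2 + e2^2 / 4 - 1 / (4 * e2^2)) - c)" for c
    using assms by (simp add: Q_def field_simps power2_eq_square power3_eq_cube power4_eq_xxxx)
  then have "Q l c e2 = 0 \<longleftrightarrow> c = l^2 + l * e2 + e2^2 / 4 - 1 / (4 * e2^2)" for c
    using assms by auto
  then show ?thesis by (simp add: c_of_def)
qed

definition light_moduli :: "(real \<times> real) set"
  where "light_moduli = {p \<in> moduli. c_of p = 0}"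

text \<open>Solutions are global, and nowhere zero so that the equation makes sense.\<close>
definition is_mu_solution :: "real \<times> real \<Rightarrow> (real \<Rightarrow> real) \<Rightarrow> bool"
  where "is_mu_solution = (\<lambda>(l, e2) \<mu>. \<mu> 0 = e2 \<and> (\<forall>s. \<mu> s \<noteq> 0) \<and>
    (\<exists>\<mu>'. \<mu>' 0 = 0 \<and>
      (\<forall>s. (\<mu> has_real_derivative \<mu>' s) (at s) \<and>
           (\<mu>' has_real_derivative
             (2 * (\<mu>' s)^2 / \<mu> s - \<mu> s - 2 * l * (\<mu> s)^4 - (\<mu> s)^5)) (at s))))"

definition mu_p :: "real \<times> real \<Rightarrow> real \<Rightarrow> real"
  where "mu_p p = (THE \<mu>. is_mu_solution p \<mu>)"

text \<open>The interval integral is oriented, so this is also the intended value for negative \<open>s\<close>.\<close>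
definition Theta_p :: "real \<times> real \<Rightarrow> real \<Rightarrow> real"
  where "Theta_p p s = - (LBINT t=ereal 0..ereal s. (mu_p p t)^2 * (mu_p p t + 2 * fst p))"

definition gamma_p :: "real \<times> real \<Rightarrow> real \<Rightarrow> real^3"
  where "gamma_p p s = (1 / (2 * sqrt 2 * mu_p p s)) *\<^sub>R
    vector [2 * (Theta_p p s)^2 + 2 * (mu_p p s)^2 + 1,
            2 * sqrt 2 * Theta_p p s,
            2 * (Theta_p p s)^2 + 2 * (mu_p p s)^2 - 1]"

end

theory Submission
  imports Defs
begin

text \<open>
  For \<open>c = 0\<close> the polynomial factors as \<open>Q(\<mu>) = w\<^sup>2 - 1\<close> with \<open>w = \<mu>\<^sup>2 + 2l\<mu>\<close>, so one may write
  \<open>w = cos \<phi>\<close> and \<open>\<mu>' = - \<mu> sin \<phi>\<close>. The phase then satisfies the scalar equation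
  \<open>\<phi>' = 2\<mu>(\<mu> + l)\<close> with \<open>\<mu> = - l + sqrt (l\<^sup>2 + cos \<phi>)\<close>, whose right-hand side is positive and
  \<open>2\<pi>\<close>-periodic in \<open>\<phi>\<close>; it is solved by inverting a primitive. As \<open>\<Theta>' = - \<mu> w\<close>, the pair
  \<open>(\<Theta>, \<mu>)\<close> is a unit speed curve in the upper half-plane, and the model curve is its image in the
  hyperboloid.

  For an arbitrary BL-curve with momentum \<open>\<xi>\<close> and a vector \<open>\<eta>\<close> orthogonal to \<open>\<xi>\<close> but not
  parallel to it, the quotient
  \<open>(\<eta> \<bullet> \<gamma>) / (\<xi> \<bullet> \<gamma>)\<close> plays the role of \<open>\<Theta>\<close>: its derivative is a non-zero multiple of \<open>\<mu> w\<close>.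
  On the other hand \<open>\<mu> w + (\<mu>' / (2\<mu>(\<mu> + l)))' = - \<mu>'\<^sup>2 / (2\<mu>(\<mu> + l)\<^sup>2)\<close>, so on a closed curve a
  periodic function would be monotone, which makes \<open>\<mu>\<close> constant.
\<close>

section \<open>Lorentzian frames of curves\<close>

lemma lprod_self_lcross:
  "(x \<times>\<^sub>L y) \<bullet>\<^sub>L (x \<times>\<^sub>L y) = (x \<bullet>\<^sub>L y)^2 - (x \<bullet>\<^sub>L x) * (y \<bullet>\<^sub>L y)"
  by (simp add: lcross_eq lprod_def) algebra

lemma lprod_lcross_left: "x \<bullet>\<^sub>L (x \<times>\<^sub>L y) = 0"
  and lprod_lcross_right: "y \<bullet>\<^sub>L (x \<times>\<^sub>L y) = 0"
  by (simp_all add: lcross_eq lprod_def algebra_simps)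

lemma lprod_commute: "x \<bullet>\<^sub>L y = y \<bullet>\<^sub>L x"
  by (simp add: lprod_def algebra_simps)

lemma lprod_add_right: "x \<bullet>\<^sub>L (y + z) = x \<bullet>\<^sub>L y + x \<bullet>\<^sub>L z"
  and lprod_diff_right: "x \<bullet>\<^sub>L (y - z) = x \<bullet>\<^sub>L y - x \<bullet>\<^sub>L z"
  and lprod_scaleR_right: "x \<bullet>\<^sub>L (r *\<^sub>R y) = r * (x \<bullet>\<^sub>L y)"
  by (simp_all add: lprod_def algebra_simps)

lemma lprod_zero_right: "x \<bullet>\<^sub>L 0 = 0"
  by (simp add: lprod_def)

lemmas lprod_right_simps = lprod_add_right lprod_diff_right lprod_scaleR_right

lemma lcross_lcross_lcross:
  "(x \<times>\<^sub>L y) \<times>\<^sub>L z = (y \<bullet>\<^sub>L z) *\<^sub>R x - (x \<bullet>\<^sub>L z) *\<^sub>R y"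
  by (simp add: lcross_eq lprod_def vec_eq_iff forall_3 algebra_simps)

lemma lcross_lcross:
  "n \<times>\<^sub>L (n \<times>\<^sub>L z) = (n \<bullet>\<^sub>L n) *\<^sub>R z - (n \<bullet>\<^sub>L z) *\<^sub>R n"
  by (simp add: lcross_eq lprod_def vec_eq_iff forall_3 algebra_simps)

lemma lcross_zero_right: "x \<times>\<^sub>L 0 = 0"
  by (simp add: lcross_eq vec_eq_iff forall_3)

text \<open>Let n be the cross product of x and y. The first triple product expansion gives n x z =
  0; the second, applied to n x (n x z) with n of square 1, then leaves z = (n . z) n.\<close>

lemma orthogonal_imp_scaleR_lcross:
  assumes "(x \<times>\<^sub>L y) \<bullet>\<^sub>L (x \<times>\<^sub>L y) = 1" "x \<bullet>\<^sub>L z = 0" "y \<bullet>\<^sub>L z = 0"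
  shows "z = ((x \<times>\<^sub>L y) \<bullet>\<^sub>L z) *\<^sub>R (x \<times>\<^sub>L y)"
proof -
  have "(x \<times>\<^sub>L y) \<times>\<^sub>L z = 0"
    using assms by (simp add: lcross_lcross_lcross)
  then show ?thesis
    using lcross_lcross[of "x \<times>\<^sub>L y" z] assms(1) by (simp add: lcross_zero_right)
qed

section \<open>Derivatives and smoothness of curves\<close>

lemma has_real_derivative_lprod:
  assumes "(f has_vector_derivative f') (at s)" "(g has_vector_derivative g') (at s)"
  shows "((\<lambda>s. f s \<bullet>\<^sub>L g s) has_real_derivative f' \<bullet>\<^sub>L g s + f s \<bullet>\<^sub>L g') (at s)"
proof -
  have nth: "((\<lambda>s. h s $ i) has_real_derivative h' $ i) (at s)"
    if "(h has_vector_derivative h') (at s)" for h :: "real \<Rightarrow> real^3" and h' i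
    using bounded_linear.has_vector_derivative[OF bounded_linear_vec_nth that]
    by (simp add: has_real_derivative_iff_has_vector_derivative)
  show ?thesis
    unfolding lprod_def
    by (rule derivative_eq_intros nth assms refl | simp add: algebra_simps)+
qed

lemma has_vector_derivative_vector_3:
  assumes "(f has_real_derivative f') (at s)" "(g has_real_derivative g') (at s)"
    "(h has_real_derivative h') (at s)"
  shows "((\<lambda>s. vector [f s, g s, h s] :: real^3) has_vector_derivative vector [f', g', h']) (at s)"
proof -
  have eq: "vector [a, b, c] = a *\<^sub>R axis 1 1 + b *\<^sub>R axis 2 1 + c *\<^sub>R (axis 3 1 :: real^3)" for a b c
    by (simp add: vec_eq_iff forall_3 axis_def)
  show ?thesis
    unfolding eq
    by (intro has_vector_derivative_add bounded_linear.has_vector_derivative[OF bounded_linear_scaleR_left]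
        assms[unfolded has_real_derivative_iff_has_vector_derivative])
qed

lemma dot_eqI: "(f has_vector_derivative f') (at s) \<Longrightarrow> dot f s = f'"
  by (simp add: dot_def vector_derivative_at)

text \<open>Gives smoothness without formulas for higher derivatives: a family in which every member
  has its derivative again in the family contains all iterates of \<open>dot\<close>.\<close>

lemma smooth_coinduct:
  assumes "f \<in> S" and step: "\<And>f. f \<in> S \<Longrightarrow> \<exists>g\<in>S. \<forall>s. (f has_vector_derivative g s) (at s)"
  shows "smooth f"
proof -
  have "(dot ^^ n) f \<in> S" for n
  proof (induction n)
    case (Suc n)
    obtain g where "g \<in> S" "\<forall>s. ((dot ^^ n) f has_vector_derivative g s) (at s)"
      using step[OF Suc] by blast
    moreover from this have "dot ((dot ^^ n) f) = g"
      by (auto intro: dot_eqI)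
    ultimately show ?case by simp
  qed (use assms in simp)
  then show ?thesis
    unfolding smooth_def using step differentiableI_vector by blast
qed

lemma smooth_has_vector_derivative:
  assumes "smooth f"
  shows "(f has_vector_derivative dot f s) (at s)"
    and "(dot f has_vector_derivative dot (dot f) s) (at s)"
proof -
  have "(dot ^^ n) f differentiable (at s)" for n
    using assms by (simp add: smooth_def)
  from this[of 0] this[of 1] show "(f has_vector_derivative dot f s) (at s)"
    "(dot f has_vector_derivative dot (dot f) s) (at s)"
    by (simp_all add: dot_def vector_derivative_works)
qed

text \<open>The orthogonality relations come from differentiating products already known to be
  constant. Lagrange's identity gives the normal the square 0 - (-1) * 1 = 1.\<close>

lemma hcurve_frame:
  assumes "hcurve \<gamma>"
  shows "\<gamma> s \<bullet>\<^sub>L \<gamma> s = -1" "dot \<gamma> s \<bullet>\<^sub>L dot \<gamma> s = 1" "\<gamma> s \<bullet>\<^sub>L dot \<gamma> s = 0"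
    and "(\<gamma> s \<times>\<^sub>L dot \<gamma> s) \<bullet>\<^sub>L (\<gamma> s \<times>\<^sub>L dot \<gamma> s) = 1"
    and "\<gamma> s \<bullet>\<^sub>L dot (dot \<gamma>) s = -1" "dot \<gamma> s \<bullet>\<^sub>L dot (dot \<gamma>) s = 0"
proof -
  have sm: "smooth \<gamma>" and gg: "\<gamma> s \<bullet>\<^sub>L \<gamma> s = -1" and dd: "dot \<gamma> s \<bullet>\<^sub>L dot \<gamma> s = 1" for s
    using assms by (auto simp: hcurve_def hyperbolic_plane_def)
  note d = smooth_has_vector_derivative[OF sm]
  have gd: "\<gamma> s \<bullet>\<^sub>L dot \<gamma> s = 0" for s
    using has_real_derivative_lprod[OF d(1)[of s] d(1)[of s]] unfolding gg
    by (auto dest!: DERIV_unique[OF _ DERIV_const] simp: lprod_commute)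
  show "\<gamma> s \<bullet>\<^sub>L \<gamma> s = -1" "dot \<gamma> s \<bullet>\<^sub>L dot \<gamma> s = 1" "\<gamma> s \<bullet>\<^sub>L dot \<gamma> s = 0"
    "(\<gamma> s \<times>\<^sub>L dot \<gamma> s) \<bullet>\<^sub>L (\<gamma> s \<times>\<^sub>L dot \<gamma> s) = 1"
    by (simp_all add: gg dd gd lprod_self_lcross)
  show "\<gamma> s \<bullet>\<^sub>L dot (dot \<gamma>) s = -1"
    using has_real_derivative_lprod[OF d(1)[of s] d(2)[of s]] unfolding gd
    by (auto dest!: DERIV_unique[OF _ DERIV_const] simp: dd)
  show "dot \<gamma> s \<bullet>\<^sub>L dot (dot \<gamma>) s = 0"
    using has_real_derivative_lprod[OF d(2)[of s] d(2)[of s]] unfolding dd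
    by (auto dest!: DERIV_unique[OF _ DERIV_const] simp: lprod_commute)
qed

text \<open>The definite description in \<open>geodesic_curvature\<close> has at most one candidate,
  because a normal of square 1 cannot vanish.\<close>

lemma geodesic_curvature_eqI:
  assumes "hcurve \<gamma>" "dot (dot \<gamma>) s = \<gamma> s + \<kappa> *\<^sub>R (\<gamma> s \<times>\<^sub>L dot \<gamma> s)"
  shows "geodesic_curvature \<gamma> s = \<kappa>"
  unfolding geodesic_curvature_def
proof (rule the_equality)
  fix k assume "dot (dot \<gamma>) s = \<gamma> s + k *\<^sub>R (\<gamma> s \<times>\<^sub>L dot \<gamma> s)"
  moreover have "\<gamma> s \<times>\<^sub>L dot \<gamma> s \<noteq> 0"
    using hcurve_frame(4)[OF assms(1), of s] by (auto simp: lprod_zero_right)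
  ultimately show "k = \<kappa>" using assms(2) by simp
qed (fact assms)

text \<open>The difference of the second derivative and \<gamma> is orthogonal to \<gamma> and to
  its tangent, hence a multiple of the normal.\<close>

lemma frenet:
  assumes "hcurve \<gamma>"
  shows "dot (dot \<gamma>) s = \<gamma> s + geodesic_curvature \<gamma> s *\<^sub>R (\<gamma> s \<times>\<^sub>L dot \<gamma> s)"
proof -
  let ?n = "\<gamma> s \<times>\<^sub>L dot \<gamma> s"
  note fr = hcurve_frame[OF assms, of s]
  have "dot (dot \<gamma>) s - \<gamma> s = (?n \<bullet>\<^sub>L (dot (dot \<gamma>) s - \<gamma> s)) *\<^sub>R ?n"
    by (intro orthogonal_imp_scaleR_lcross) (simp_all add: lprod_right_simps fr lprod_commute[of "dot \<gamma> s" "\<gamma> s"])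
  then have "dot (dot \<gamma>) s = \<gamma> s + (?n \<bullet>\<^sub>L (dot (dot \<gamma>) s - \<gamma> s)) *\<^sub>R ?n"
    by (simp add: algebra_simps)
  with geodesic_curvature_eqI[OF assms this] show ?thesis by simp
qed

section \<open>Scalar autonomous equations\<close>

lemma continuous_antiderivative:
  fixes f :: "real \<Rightarrow> real"
  assumes "\<And>x. isCont f x"
  obtains F where "\<And>x. (F has_real_derivative f x) (at x)" "F a = b"
proof -
  obtain F where F: "\<And>x. (F has_real_derivative f x) (at x)"
    using einterval_antiderivative[of "-\<infinity>" "\<infinity>" f] assms
    by (auto simp: has_real_derivative_iff_has_vector_derivative)
  have "((\<lambda>x. F x - F a + b) has_real_derivative f x) (at x)" for x
    by (auto intro!: derivative_eq_intros F)
  then show ?thesis using that[of "\<lambda>x. F x - F a + b"] by simp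
qed

lemma DERIV_zero_imp_const:
  fixes f :: "real \<Rightarrow> real"
  assumes "\<And>x. (f has_real_derivative 0) (at x)"
  shows "f x = f y"
  by (intro DERIV_isconst_all allI assms)

lemma DERIV_pos_imp_strict_mono:
  fixes f :: "real \<Rightarrow> real"
  assumes "\<And>x. (f has_real_derivative f' x) (at x)" "\<And>x. f' x > 0"
  shows "strict_mono f"
proof (rule strict_monoI)
  fix x y :: real
  assume "x < y"
  show "f x < f y"
    by (rule DERIV_pos_imp_increasing[OF \<open>x < y\<close>]) (use assms in blast)
qed

text \<open>Separation of variables: for a primitive G of 1/F, every solution \<zeta> satisfies
  G(\<zeta>(s)) = G(\<zeta>(0)) + s, and G is injective. Positivity of F takes the place of a
  Lipschitz condition.\<close>

lemma scalar_ode_unique: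
  fixes F \<phi> \<psi> :: "real \<Rightarrow> real"
  assumes F: "\<And>x. isCont F x" "\<And>x. F x > 0"
    and phi: "\<And>s. (\<phi> has_real_derivative F (\<phi> s)) (at s)"
    and psi: "\<And>s. (\<psi> has_real_derivative F (\<psi> s)) (at s)"
    and "\<phi> 0 = \<psi> 0"
  shows "\<phi> = \<psi>"
proof
  fix s
  have "isCont (\<lambda>x. 1 / F x) x" for x
    using F(1)[of x] F(2)[of x] by (intro continuous_intros) auto
  then obtain G where G: "\<And>x. (G has_real_derivative 1 / F x) (at x)"
    by (rule continuous_antiderivative[where a = 0 and b = 0]) blast
  have mono: "strict_mono G"
    by (rule DERIV_pos_imp_strict_mono[OF G]) (use F(2) in simp)
  have travel: "G (\<zeta> s) = G (\<zeta> 0) + s" if zeta: "\<And>s. (\<zeta> has_real_derivative F (\<zeta> s)) (at s)" for \<zeta>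
  proof -
    have "((\<lambda>s. G (\<zeta> s) - s) has_real_derivative 0) (at s)" for s
      using F(2)[of "\<zeta> s"] by (auto intro!: derivative_eq_intros DERIV_chain2[OF G] zeta)
    from DERIV_zero_imp_const[OF this, of s 0] show ?thesis by simp
  qed
  have "G (\<phi> s) = G (\<psi> s)"
    by (simp add: travel[of \<phi>, OF phi] travel[of \<psi>, OF psi] assms(5))
  then show "\<phi> s = \<psi> s"
    by (simp add: strict_mono_eq[OF mono])
qed

text \<open>The solution is the inverse of the primitive G of 1/F with G(a) = 0. Periodicity of F
  makes G commute with a shift by p up to a constant, which both yields the quasi-period T and makes
  G onto, so that the solution is global.\<close>

lemma scalar_ode_rotation:
  fixes F :: "real \<Rightarrow> real"
  assumes F: "\<And>x. isCont F x" "\<And>x. F x > 0" and per: "\<And>x. F (x + p) = F x" and "p > 0"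
  obtains \<phi> T where "T > 0" "\<phi> 0 = a" "\<And>s. (\<phi> has_real_derivative F (\<phi> s)) (at s)"
    "\<And>s. \<phi> (s + T) = \<phi> s + p" "surj \<phi>"
proof -
  have "isCont (\<lambda>x. 1 / F x) x" for x
    using F(1)[of x] F(2)[of x] by (intro continuous_intros) auto
  then obtain G where G: "\<And>x. (G has_real_derivative 1 / F x) (at x)" and G0: "G a = 0"
    by (rule continuous_antiderivative[where a = a and b = 0]) blast
  have contG: "isCont G x" for x
    using G DERIV_isCont by blast
  have mono: "strict_mono G"
    by (rule DERIV_pos_imp_strict_mono[OF G]) (use F(2) in simp)
  \<comment> \<open>G measures the time elapsed since leaving a, so T is the time needed to cross
    one period of F.\<close>
  define T where "T = G (a + p)"
  have "T > 0"
    using strict_monoD[OF mono, of a "a + p"] \<open>p > 0\<close> G0 by (simp add: T_def)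
  have GT: "G (x + p) = G x + T" for x
  proof -
    have "((\<lambda>x. G (x + p) - G x) has_real_derivative 0) (at x)" for x
      using per[of x] by (auto intro!: derivative_eq_intros G DERIV_chain2[OF G])
    from DERIV_zero_imp_const[OF this, of x a] show ?thesis by (simp add: T_def G0)
  qed
  \<comment> \<open>These values show that G is unbounded in both directions; the intermediate value
    theorem then makes it surjective.\<close>
  have GnT: "G (a + of_nat n * p) = of_nat n * T" "G (a - of_nat n * p) = - (of_nat n * T)" for n
  proof (induction n)
    case (Suc n)
    { case 1 show ?case
        using GT[of "a + of_nat n * p"] Suc by (simp add: algebra_simps) }
    { case 2 show ?case
        using GT[of "a - of_nat (Suc n) * p"] Suc by (simp add: algebra_simps) }
  qed (simp_all add: G0)
  have "\<exists>x. G x = s" for s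
  proof -
    obtain n where n: "\<bar>s\<bar> < of_nat n * T"
      using reals_Archimedean3[OF \<open>T > 0\<close>] by blast
    have "\<exists>x\<ge>a - of_nat n * p. x \<le> a + of_nat n * p \<and> G x = s"
      using n \<open>p > 0\<close> by (intro IVT) (auto simp: GnT contG)
    then show ?thesis by blast
  qed
  then have surjG: "surj G" by (metis surjI)
  have injG: "inj G"
    using mono by (rule strict_mono_imp_inj_on)
  define \<phi> where "\<phi> = inv G"
  have phiG: "\<phi> (G x) = x" and Gphi: "G (\<phi> s) = s" for x s
    by (simp_all add: \<phi>_def injG surjG surj_f_inv_f)
  show ?thesis
  proof
    show "\<phi> 0 = a" using phiG[of a] by (simp add: G0)
    show "surj \<phi>" using phiG by (metis surjI)
    show "\<phi> (s + T) = \<phi> s + p" for s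
      using phiG[of "\<phi> s + p"] by (simp add: GT Gphi)
    show "(\<phi> has_real_derivative F (\<phi> s)) (at s)" for s
    proof -
      have "isCont \<phi> (G (\<phi> s))"
        by (rule isCont_inverse_function[of 1]) (simp_all add: phiG contG)
      then have "(\<phi> has_real_derivative inverse (1 / F (\<phi> s))) (at s)"
        using F(2)[of "\<phi> s"]
        by (intro DERIV_inverse_function[of G _ _ _ "s - 1" "s + 1"] G) (simp_all add: Gphi less_imp_neq)
      then show ?thesis by simp
    qed
  qed (fact \<open>T > 0\<close>)
qed


section \<open>The phase of the Blaschke invariant\<close>

text \<open>With w = e^2 + 2le, the condition c = 0 reads w^2 = 1 and the inequality in
  \<open>moduli\<close> reads e^2 w < -1. Together they force w = -1, a quadratic equation for e,
  and e > 1.\<close>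

lemma light_moduli_iff:
  "(l, e) \<in> light_moduli \<longleftrightarrow> l < -1 \<and> e = - l + sqrt (l^2 - 1)"
proof
  assume "(l, e) \<in> light_moduli"
  then have e: "e > 0" "e^4 + 2 * l * e^3 + 1 < 0" and c: "c_of (l, e) = 0"
    by (auto simp: light_moduli_def moduli_def)
  define w where "w = e^2 + 2 * l * e"
  have "w^2 - 1 = 4 * e^2 * (l^2 + l * e + e^2 / 4 - 1 / (4 * e^2))"
    using e(1) unfolding w_def
    by (simp add: field_simps power2_eq_square power4_eq_xxxx)
  also have "\<dots> = 0"
    using c e(1) by (simp add: c_of_eq)
  finally have w2: "w = 1 \<or> w = -1"
    by (simp add: power2_eq_1_iff)
  have ew: "e^2 * w < -1"
    using e(2) by (simp add: w_def algebra_simps power2_eq_square power3_eq_cube power4_eq_xxxx)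
  have "w \<noteq> 1"
    using ew by (smt (verit) zero_le_power2 mult_cancel_left1)
  then have w: "w = -1"
    using w2 by simp
  with ew have e2: "e^2 > 1" by simp
  then have "e > 1"
    using e(1) by (smt (verit) power_le_one)
  \<comment> \<open>All three identities restate w = -1. The first yields l < -1, the second selects
    the larger root of the quadratic.\<close>
  have "2 * e * (- l - 1) = (e - 1)^2" "2 * e * (e + l) = e^2 - 1" and el: "(e + l)^2 = l^2 - 1"
    using w by (auto simp: w_def algebra_simps power2_eq_square)
  then have "0 < 2 * e * (- l - 1)" "0 < 2 * e * (e + l)"
    using \<open>e > 1\<close> e2 by simp_all
  then have "- l - 1 > 0" "e + l > 0"
    using e(1) by (simp_all add: zero_less_mult_iff)
  with el show "l < -1 \<and> e = - l + sqrt (l^2 - 1)"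
    using real_sqrt_unique[of "e + l" "l^2 - 1"] by simp
next
  assume "l < -1 \<and> e = - l + sqrt (l^2 - 1)"
  then have l: "l < -1" and e: "e = - l + sqrt (l^2 - 1)" by auto
  have "l^2 > 1" using l one_less_power[of "- l" 2] by simp
  then have "sqrt (l^2 - 1) > 0" "(sqrt (l^2 - 1))^2 = l^2 - 1" by auto
  with e have el: "e + l > 0" "(e + l)^2 = l^2 - 1" by auto
  then have "e > 1" using l by auto
  have w: "e^2 + 2 * l * e = -1" using el(2) by (simp add: power2_eq_square algebra_simps)
  have "e^4 + 2 * l * e^3 = - (e^2)" using w by algebra
  moreover have "e^2 > 1" using \<open>e > 1\<close> by (simp add: one_less_power)
  moreover have "4 * e^2 * (l^2 + l * e + e^2 / 4 - 1 / (4 * e^2)) = (e^2 + 2 * l * e)^2 - 1"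
    using \<open>e > 1\<close> by (simp add: field_simps power2_eq_square power4_eq_xxxx)
  then have "l^2 + l * e + e^2 / 4 - 1 / (4 * e^2) = 0"
    using w \<open>e > 1\<close> by simp
  ultimately show "(l, e) \<in> light_moduli"
    using \<open>e > 1\<close> by (simp add: light_moduli_def moduli_def c_of_eq)
qed

section \<open>The phase equation and its equivalence with the equation for \<mu>\<close>

lemma nonvanishing_imp_pos:
  fixes f :: "real \<Rightarrow> real"
  assumes "\<And>x. isCont f x" "\<And>x. f x \<noteq> 0" "f a > 0"
  shows "f x > 0"
proof (rule ccontr)
  assume neg: "\<not> f x > 0"
  have cont: "continuous_on A f" for A
    using assms(1) by (simp add: continuous_at_imp_continuous_on)
  have "\<exists>z. f z = 0"
    using IVT'[of f x 0 a] IVT2'[of f x 0 a] neg assms(3) cont by (metis less_imp_le linear not_le)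
  then show False using assms(2) by blast
qed

text \<open>The larger root m of m^2 + 2lm = cos x.\<close>

definition mu_of_phase :: "real \<Rightarrow> real \<Rightarrow> real"
  where "mu_of_phase l x = - l + sqrt (l^2 + cos x)"

lemma mu_of_phase:
  assumes "l < -1"
  shows "l^2 + cos x > 0" "mu_of_phase l x + l > 0" "mu_of_phase l x > 0"
    and "(mu_of_phase l x)^2 + 2 * l * mu_of_phase l x = cos x"
proof -
  have "l^2 > 1" using assms one_less_power[of "- l" 2] by simp
  moreover have "cos x \<ge> -1" by simp
  ultimately show pos: "l^2 + cos x > 0" by linarith
  then show ml: "mu_of_phase l x + l > 0" by (simp add: mu_of_phase_def)
  then show "mu_of_phase l x > 0" using assms by simp
  have "(mu_of_phase l x + l)^2 = l^2 + cos x"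
    using pos by (simp add: mu_of_phase_def)
  then show "(mu_of_phase l x)^2 + 2 * l * mu_of_phase l x = cos x"
    by (simp add: power2_eq_square algebra_simps)
qed

text \<open>The initial phase pi encodes both initial conditions: w = cos pi = -1 is the value at
  \<open>e2\<close>, and sin pi = 0 makes \<mu>' vanish.\<close>

definition is_phase :: "real \<Rightarrow> (real \<Rightarrow> real) \<Rightarrow> bool"
  where "is_phase l \<phi> \<longleftrightarrow> \<phi> 0 = pi \<and>
    (\<forall>s. (\<phi> has_real_derivative 2 * mu_of_phase l (\<phi> s) * (mu_of_phase l (\<phi> s) + l)) (at s))"

lemma is_phase_unique:
  assumes "l < -1" "is_phase l \<phi>" "is_phase l \<psi>"
  shows "\<phi> = \<psi>"
proof (rule scalar_ode_unique[where F = "\<lambda>x. 2 * mu_of_phase l x * (mu_of_phase l x + l)"])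
  show "isCont (\<lambda>x. 2 * mu_of_phase l x * (mu_of_phase l x + l)) x" for x
    unfolding mu_of_phase_def by (intro continuous_intros)
qed (use assms mu_of_phase in \<open>auto simp: is_phase_def\<close>)

lemma is_phase_exists:
  assumes "l < -1"
  obtains \<phi> T where "is_phase l \<phi>" "T > 0" "\<And>s. \<phi> (s + T) = \<phi> s + 2 * pi" "surj \<phi>"
proof (rule scalar_ode_rotation
    [where F = "\<lambda>x. 2 * mu_of_phase l x * (mu_of_phase l x + l)" and p = "2 * pi" and a = pi])
  show "isCont (\<lambda>x. 2 * mu_of_phase l x * (mu_of_phase l x + l)) x" for x
    unfolding mu_of_phase_def by (intro continuous_intros)
  show "2 * mu_of_phase l x * (mu_of_phase l x + l) > 0" for x
    using mu_of_phase[OF assms, of x] by simp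
qed (auto simp: mu_of_phase_def is_phase_def intro: that)

text \<open>The factor \<mu> + l of the phase velocity is the square root itself, so it cancels
  against the denominator produced by differentiating that root.\<close>

lemma DERIV_mu_of_phase:
  assumes "l < -1" "is_phase l \<phi>"
  shows "((\<lambda>s. mu_of_phase l (\<phi> s)) has_real_derivative - (mu_of_phase l (\<phi> s) * sin (\<phi> s))) (at s)"
proof -
  have "(\<phi> has_real_derivative 2 * mu_of_phase l (\<phi> s) * sqrt (l^2 + cos (\<phi> s))) (at s)"
    using assms(2) by (simp add: is_phase_def mu_of_phase_def)
  then show ?thesis
    using mu_of_phase[OF assms(1), of "\<phi> s"] unfolding mu_of_phase_def
    by (auto intro!: derivative_eq_intros simp: field_simps)
qed

lemma is_phase_imp_mu_solution:
  assumes l: "l < -1" and "is_phase l \<phi>"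
  shows "is_mu_solution (l, - l + sqrt (l^2 - 1)) (\<lambda>s. mu_of_phase l (\<phi> s))"
proof -
  let ?m = "\<lambda>s. mu_of_phase l (\<phi> s)"
  have "((\<lambda>s. - (?m s * sin (\<phi> s))) has_real_derivative
      2 * (- (?m s * sin (\<phi> s)))^2 / ?m s - ?m s - 2 * l * (?m s)^4 - (?m s)^5) (at s)" for s
  proof -
    define m c d where "m = ?m s" and "c = cos (\<phi> s)" and "d = sin (\<phi> s)"
    have m: "m > 0" "m^2 + 2 * l * m = c" and cd: "c^2 + d^2 = 1"
      using mu_of_phase[OF l, of "\<phi> s"] by (auto simp: m_def c_def d_def)
    have "((\<lambda>s. - (?m s * sin (\<phi> s))) has_real_derivative m * d^2 - m * c * (2 * m * (m + l))) (at s)"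
      using assms(2) by (auto intro!: derivative_eq_intros DERIV_mu_of_phase[OF assms]
        simp: is_phase_def m_def c_def d_def power2_eq_square algebra_simps)
    \<comment> \<open>Eliminating d^2 = 1 - c^2 and then c = m^2 + 2lm leaves the same polynomial in
      m and l on both sides.\<close>
    also have "m * d^2 - m * c * (2 * m * (m + l)) = 2 * m * d^2 - m - 2 * l * m^4 - m^5"
    proof -
      have d2: "d^2 = 1 - c^2" using cd by simp
      show ?thesis unfolding d2 m(2)[symmetric] by (simp add: algebra_simps eval_nat_numeral)
    qed
    also have "\<dots> = 2 * (- (m * d))^2 / m - m - 2 * l * m^4 - m^5"
      using m(1) by (simp add: power2_eq_square)
    finally show ?thesis by (simp add: m_def d_def)
  qed
  moreover have "?m 0 = - l + sqrt (l^2 - 1)"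
    using assms(2) by (simp add: is_phase_def mu_of_phase_def)
  moreover have "?m s \<noteq> 0" for s
    using mu_of_phase(3)[OF l, of "\<phi> s"] by simp
  ultimately show ?thesis
    using assms(2) DERIV_mu_of_phase[OF assms] unfolding is_mu_solution_def
    by (auto simp: is_phase_def intro!: exI[of _ "\<lambda>s. - (?m s * sin (\<phi> s))"])
qed

text \<open>
  The conserved energy \<open>(\<mu>'/\<mu>)\<^sup>2 + (\<mu>\<^sup>2 + 2l\<mu>)\<^sup>2 = 1\<close> puts the pair on the unit circle, where it rotates
  with angular velocity \<open>2\<mu>(\<mu> + l)\<close>.
\<close>
lemma mu_solution_imp_phase:
  assumes l: "l < -1" and sol: "is_mu_solution (l, - l + sqrt (l^2 - 1)) \<mu>"
  obtains \<phi> where "is_phase l \<phi>" "\<mu> = (\<lambda>s. mu_of_phase l (\<phi> s))"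
proof -
  have l2: "l^2 > 1" using l one_less_power[of "- l" 2] by simp
  obtain \<mu>' where mu0: "\<mu> 0 = - l + sqrt (l^2 - 1)" "\<mu>' 0 = 0" and nz: "\<And>s. \<mu> s \<noteq> 0"
    and d1: "\<And>s. (\<mu> has_real_derivative \<mu>' s) (at s)"
    and d2: "\<And>s. (\<mu>' has_real_derivative
               2 * (\<mu>' s)^2 / \<mu> s - \<mu> s - 2 * l * (\<mu> s)^4 - (\<mu> s)^5) (at s)"
    using sol by (auto simp: is_mu_solution_def)
  define w R where "w s = (\<mu> s)^2 + 2 * l * \<mu> s" and "R s = \<mu>' s / \<mu> s" for s
  have w0: "w 0 = -1" and R0: "R 0 = 0"
    using l2 by (simp_all add: w_def R_def mu0 power2_eq_square algebra_simps)
  have dmu: "(\<mu> has_real_derivative \<mu> s * R s) (at s)" for s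
    using d1[of s] nz[of s] by (simp add: R_def)
  have dw: "(w has_real_derivative 2 * \<mu> s * (\<mu> s + l) * R s) (at s)" for s
    unfolding w_def by (auto intro!: derivative_eq_intros dmu simp: algebra_simps power2_eq_square)
  have dR': "(R has_real_derivative R s^2 - 1 - 2 * l * \<mu> s ^ 3 - \<mu> s ^ 4) (at s)" for s
    unfolding R_def using nz[of s]
    by (auto intro!: derivative_eq_intros d1 d2
        simp: field_simps power2_eq_square power3_eq_cube power4_eq_xxxx eval_nat_numeral)
  have energy: "w s ^ 2 + R s ^ 2 = 1" for s
  proof -
    \<comment> \<open>The defect \<open>E = w\<^sup>2 + R\<^sup>2 - 1\<close> satisfies \<open>E' = 2 R E\<close>, with integrating factor \<open>\<mu>\<^sup>-\<^sup>2\<close>.\<close>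
    define f where "f s = (w s ^ 2 + R s ^ 2 - 1) / \<mu> s ^ 2" for s
    have "(f has_real_derivative 0) (at s)" for s
      unfolding f_def using nz[of s]
      by (auto intro!: derivative_eq_intros dw dR' dmu, simp add: w_def field_simps)
        (simp add: algebra_simps power2_eq_square power3_eq_cube power4_eq_xxxx eval_nat_numeral)
    from DERIV_zero_imp_const[OF this, of s 0] show ?thesis
      using nz by (simp add: f_def w0 R0)
  qed
  have dR: "(R has_real_derivative - (2 * \<mu> s * (\<mu> s + l) * w s)) (at s)" for s
  proof -
    have "R s^2 - 1 - 2 * l * \<mu> s ^ 3 - \<mu> s ^ 4 = - (2 * \<mu> s * (\<mu> s + l) * w s)"
      using energy[of s] w_def[of s] by algebra
    with dR'[of s] show ?thesis by simp
  qed
  have contmu: "isCont \<mu> s" for s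
    using d1 DERIV_isCont by blast
  then have "isCont (\<lambda>s. 2 * \<mu> s * (\<mu> s + l)) s" for s
    by (intro continuous_intros)
  \<comment> \<open>Here \<phi> merely integrates the angular velocity along the given \<mu>; it
    becomes a phase in the sense of \<open>is_phase\<close> once \<mu> is expressed through
    it.\<close>
  then obtain \<phi> where dphi: "\<And>s. (\<phi> has_real_derivative 2 * \<mu> s * (\<mu> s + l)) (at s)"
    and phi0: "\<phi> 0 = pi"
    by (rule continuous_antiderivative[where a = 0 and b = pi]) blast
  \<comment> \<open>The unit vectors (w, R) and (cos \<phi>, - sin \<phi>) rotate with the same
    velocity, so their Euclidean inner product A keeps its initial value 1, which forces them to
    agree.\<close>
  have cosphi: "w s = cos (\<phi> s)" for s
  proof -
    define A where "A s = w s * cos (\<phi> s) - R s * sin (\<phi> s)" for s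
    have "(A has_real_derivative 0) (at s)" for s
      unfolding A_def by (auto intro!: derivative_eq_intros dw dR dphi simp: algebra_simps)
    from DERIV_zero_imp_const[OF this, of s 0] have "A s = 1"
      by (simp add: A_def w0 R0 phi0)
    moreover have "(w s - cos (\<phi> s))^2 + (R s + sin (\<phi> s))^2
        = (w s ^ 2 + R s ^ 2) + ((cos (\<phi> s))^2 + (sin (\<phi> s))^2) - 2 * A s"
      unfolding A_def by (simp add: power2_eq_square algebra_simps)
    ultimately show ?thesis
      using energy[of s] by simp
  qed
  have sq: "(\<mu> s + l)^2 = l^2 + cos (\<phi> s)" for s
    using cosphi[of s] by (simp add: w_def power2_eq_square algebra_simps)
  \<comment> \<open>The square fixes \<mu> + l only up to sign. Since it never vanishes, continuity
    preserves the sign it has at 0.\<close>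
  have "\<mu> s + l > 0" for s
  proof (rule nonvanishing_imp_pos[of "\<lambda>s. \<mu> s + l" 0])
    show "\<mu> s + l \<noteq> 0" for s
      using sq[of s] mu_of_phase(1)[OF l, of "\<phi> s"] by auto
  qed (use l2 mu0 contmu in \<open>auto intro!: continuous_intros\<close>)
  then have mu: "\<mu> s = mu_of_phase l (\<phi> s)" for s
    using sq[of s] by (smt (verit) mu_of_phase_def real_sqrt_unique)
  show ?thesis
  proof
    show "is_phase l \<phi>" using dphi phi0 by (simp add: is_phase_def mu)
  qed (use mu in auto)
qed

text \<open>Resolves the definite description in \<open>mu_p\<close>: every solution comes from a
  phase, and the phase is unique.\<close>

lemma mu_p_eq:
  assumes "(l, e) \<in> light_moduli" "is_phase l \<phi>"
  shows "mu_p (l, e) = (\<lambda>s. mu_of_phase l (\<phi> s))"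
proof -
  have l: "l < -1" and e: "e = - l + sqrt (l^2 - 1)"
    using assms(1) by (simp_all add: light_moduli_iff)
  show ?thesis
    unfolding mu_p_def e
  proof (rule the_equality)
    fix \<nu> assume "is_mu_solution (l, - l + sqrt (l^2 - 1)) \<nu>"
    then show "\<nu> = (\<lambda>s. mu_of_phase l (\<phi> s))"
      using mu_solution_imp_phase[OF l] is_phase_unique[OF l] assms(2) by metis
  qed (rule is_phase_imp_mu_solution[OF l assms(2)])
qed

section \<open>The model curves\<close>

text \<open>Coordinates in a basis adapted to the momentum: a belongs to the light-like vector
  (1,0,1)/sqrt 2, b to the light-like vector (1,0,-1)/(2 sqrt 2), and c to the unit vector (0,1,0)
  orthogonal to both.\<close>

definition null_vec :: "real \<Rightarrow> real \<Rightarrow> real \<Rightarrow> real^3"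
  where "null_vec a b c = vector [(a + b / 2) / sqrt 2, c, (a - b / 2) / sqrt 2]"

lemma null_vec_lprod: "null_vec a b c \<bullet>\<^sub>L null_vec a' b' c' = c * c' - (a * b' + b * a') / 2"
  by (simp add: null_vec_def lprod_def field_simps)

lemma null_vec_lcross:
  "null_vec a b c \<times>\<^sub>L null_vec a' b' c' = null_vec (a * c' - c * a') (c * b' - b * c') ((a * b' - b * a') / 2)"
  by (simp add: null_vec_def lcross_eq vec_eq_iff forall_3 field_simps)

lemma null_vec_linear:
  "null_vec a b c + null_vec a' b' c' = null_vec (a + a') (b + b') (c + c')"
  "null_vec a b c - null_vec a' b' c' = null_vec (a - a') (b - b') (c - c')"
  "r *\<^sub>R null_vec a b c = null_vec (r * a) (r * b) (r * c)"
  by (simp_all add: null_vec_def vec_eq_iff forall_3 field_simps)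

lemma has_vector_derivative_null_vec:
  assumes "(f has_real_derivative f') (at s)" "(g has_real_derivative g') (at s)"
    "(h has_real_derivative h') (at s)"
  shows "((\<lambda>s. null_vec (f s) (g s) (h s)) has_vector_derivative null_vec f' g' h') (at s)"
  unfolding null_vec_def
  by (intro has_vector_derivative_vector_3 DERIV_cdivide DERIV_add DERIV_diff assms)

locale light_model =
  fixes l e :: real and \<phi> :: "real \<Rightarrow> real"
  assumes moduli: "(l, e) \<in> light_moduli" and phase: "is_phase l \<phi>"
begin

definition x :: "real \<Rightarrow> real" where "x = Theta_p (l, e)"
definition y :: "real \<Rightarrow> real" where "y = mu_p (l, e)"
text \<open>Naming the reciprocal makes the frame and the derivatives polynomial in x, y, b, c, d,
  so that the later identities follow by \<open>algebra\<close> from the relations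
  \<open>rel\<close>.\<close>

definition b :: "real \<Rightarrow> real" where "b s = 1 / y s"
definition c :: "real \<Rightarrow> real" where "c s = cos (\<phi> s)"
definition d :: "real \<Rightarrow> real" where "d s = sin (\<phi> s)"

section \<open>Relations and derivatives of the half-plane coordinates\<close>

lemma l_less: "l < -1" and e_eq: "e = - l + sqrt (l^2 - 1)"
  using moduli by (simp_all add: light_moduli_iff)

lemma y_eq: "y s = mu_of_phase l (\<phi> s)"
  by (simp add: y_def mu_p_eq[OF moduli phase])

lemma y_pos: "y s > 0"
  and rel: "b s * y s = 1" "(c s)^2 + (d s)^2 = 1" "(y s)^2 + 2 * l * y s = c s"
  using mu_of_phase(3,4)[OF l_less, of "\<phi> s"] by (simp_all add: y_eq b_def c_def d_def)

lemma DERIV_y: "(y has_real_derivative - (y s * d s)) (at s)"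
  using DERIV_mu_of_phase[OF l_less phase, of s] unfolding y_eq[symmetric] d_def .

lemma DERIV_b: "(b has_real_derivative b s * d s) (at s)"
  unfolding b_def[abs_def] using y_pos[of s]
  by (auto intro!: derivative_eq_intros DERIV_y simp: field_simps)

lemma DERIV_phase: "(\<phi> has_real_derivative 2 * y s * (y s + l)) (at s)"
  using phase by (simp add: is_phase_def y_eq)

lemma DERIV_c: "(c has_real_derivative - (d s * (2 * y s * (y s + l)))) (at s)"
  unfolding c_def[abs_def] d_def
  by (auto intro!: derivative_eq_intros DERIV_phase simp: algebra_simps)

lemma DERIV_d: "(d has_real_derivative c s * (2 * y s * (y s + l))) (at s)"
  unfolding d_def[abs_def] c_def
  by (auto intro!: derivative_eq_intros DERIV_phase simp: algebra_simps)

lemma DERIV_x: "(x has_real_derivative - (y s * c s)) (at s)"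
proof -
  have cont: "isCont (\<lambda>t. y t * c t) t" for t
    by (intro continuous_intros DERIV_isCont[OF DERIV_y] DERIV_isCont[OF DERIV_c])
  then obtain F where F: "\<And>t. (F has_real_derivative y t * c t) (at t)" "F 0 = 0"
    by (rule continuous_antiderivative[where a = 0 and b = 0]) blast
  have "x t = - F t" for t
  proof -
    have "(LBINT u=ereal 0..ereal t. y u * c u) = F t - F 0"
    proof (rule interval_integral_FTC_finite)
      show "continuous_on {min 0 t..max 0 t} (\<lambda>u. y u * c u)"
        using cont by (simp add: continuous_at_imp_continuous_on)
      show "(F has_vector_derivative y u * c u) (at u within {min 0 t..max 0 t})" for u
        using F(1)[of u]
        by (simp add: has_real_derivative_iff_has_vector_derivative has_vector_derivative_at_within)
    qed
    \<comment> \<open>Identifies the integrand of \<open>Theta_p\<close> with y c.\<close>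
    moreover have "(y u)^2 * (y u + 2 * l) = y u * c u" for u
      using rel(3)[of u, symmetric] by (simp add: power2_eq_square algebra_simps)
    ultimately show ?thesis
      by (simp add: x_def Theta_p_def F(2) flip: y_def)
  qed
  then have "x = (\<lambda>t. - F t)" by blast
  then show ?thesis using DERIV_minus[OF F(1)] by simp
qed

lemmas DERIVs = DERIV_x DERIV_y DERIV_b DERIV_c DERIV_d

text \<open>In null coordinates the model curve is the image of the half-plane point (x, y) under
  the standard isometry to the hyperboloid.\<close>

lemma gamma_p_eq: "gamma_p (l, e) = (\<lambda>s. null_vec ((x s)^2 * b s + y s) (b s) (x s * b s))"
proof
  fix s
  have "y s \<noteq> 0" using y_pos[of s] by simp
  then show "gamma_p (l, e) s = null_vec ((x s)^2 * b s + y s) (b s) (x s * b s)"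
    unfolding gamma_p_def x_def[symmetric] y_def[symmetric] null_vec_def b_def vec_eq_iff forall_3
    by (simp add: field_simps power2_eq_square)
qed

text \<open>The algebra of functions generated by the five coordinates. It is closed under
  differentiation because the generators have polynomial derivatives, as
  \<open>smooth_coinduct\<close> requires.\<close>

inductive_set coordinate_algebra :: "(real \<Rightarrow> real) set" where
  const: "(\<lambda>s. r) \<in> coordinate_algebra"
| x: "x \<in> coordinate_algebra"
| y: "y \<in> coordinate_algebra"
| b: "b \<in> coordinate_algebra"
| c: "c \<in> coordinate_algebra"
| d: "d \<in> coordinate_algebra"
| add: "f \<in> coordinate_algebra \<Longrightarrow> g \<in> coordinate_algebra \<Longrightarrow> (\<lambda>s. f s + g s) \<in> coordinate_algebra"
| mult: "f \<in> coordinate_algebra \<Longrightarrow> g \<in> coordinate_algebra \<Longrightarrow> (\<lambda>s. f s * g s) \<in> coordinate_algebra"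

lemma coordinate_algebra_minus: "f \<in> coordinate_algebra \<Longrightarrow> (\<lambda>s. - f s) \<in> coordinate_algebra"
  using coordinate_algebra.mult[OF coordinate_algebra.const[of "-1"], of f] by simp

lemma coordinate_algebra_DERIV:
  assumes "f \<in> coordinate_algebra"
  shows "\<exists>g\<in>coordinate_algebra. \<forall>s. (f has_real_derivative g s) (at s)"
  using assms
proof induction
  case (const r)
  show ?case by (intro bexI[of _ "\<lambda>s. 0"] coordinate_algebra.const) simp
next
  case x
  show ?case
    by (rule bexI[of _ "\<lambda>s. - (y s * c s)"])
      (intro allI DERIVs coordinate_algebra_minus coordinate_algebra.intros)+
next
  case y
  show ?case
    by (rule bexI[of _ "\<lambda>s. - (y s * d s)"])
      (intro allI DERIVs coordinate_algebra_minus coordinate_algebra.intros)+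
next
  case b
  show ?case
    by (rule bexI[of _ "\<lambda>s. b s * d s"]) (intro allI DERIVs coordinate_algebra.intros)+
next
  case c
  show ?case
    by (rule bexI[of _ "\<lambda>s. - (d s * (2 * y s * (y s + l)))"])
      (intro allI DERIVs coordinate_algebra_minus coordinate_algebra.intros)+
next
  case d
  show ?case
    by (rule bexI[of _ "\<lambda>s. c s * (2 * y s * (y s + l))"])
      (intro allI DERIVs coordinate_algebra.intros)+
next
  case (add f g)
  then obtain f' g' where "f' \<in> coordinate_algebra" "g' \<in> coordinate_algebra"
    "\<forall>s. (f has_real_derivative f' s) (at s)" "\<forall>s. (g has_real_derivative g' s) (at s)" by blast
  then show ?case
    by (intro bexI[of _ "\<lambda>s. f' s + g' s"] coordinate_algebra.add) (auto intro!: derivative_eq_intros)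
next
  case (mult f g)
  then obtain f' g' where "f' \<in> coordinate_algebra" "g' \<in> coordinate_algebra"
    "\<forall>s. (f has_real_derivative f' s) (at s)" "\<forall>s. (g has_real_derivative g' s) (at s)" by blast
  with mult show ?case
    by (intro bexI[of _ "\<lambda>s. f' s * g s + g' s * f s"] coordinate_algebra.add coordinate_algebra.mult)
      (auto intro!: derivative_eq_intros)
qed

lemma smooth_gamma_p: "smooth (gamma_p (l, e))"
proof (rule smooth_coinduct[where S = "{\<lambda>s. null_vec (f s) (g s) (h s) | f g h.
    f \<in> coordinate_algebra \<and> g \<in> coordinate_algebra \<and> h \<in> coordinate_algebra}"])
  have "(\<lambda>s. (x s)^2 * b s + y s) \<in> coordinate_algebra" "(\<lambda>s. x s * b s) \<in> coordinate_algebra"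
    unfolding power2_eq_square by (intro coordinate_algebra.intros)+
  then show "gamma_p (l, e) \<in> {\<lambda>s. null_vec (f s) (g s) (h s) | f g h.
      f \<in> coordinate_algebra \<and> g \<in> coordinate_algebra \<and> h \<in> coordinate_algebra}"
    unfolding gamma_p_eq mem_Collect_eq using coordinate_algebra.b
    by (intro exI[of _ "\<lambda>s. (x s)^2 * b s + y s"] exI[of _ b] exI[of _ "\<lambda>s. x s * b s"] conjI refl)
next
  fix F assume "F \<in> {\<lambda>s. null_vec (f s) (g s) (h s) | f g h.
    f \<in> coordinate_algebra \<and> g \<in> coordinate_algebra \<and> h \<in> coordinate_algebra}"
  then obtain f g h where F: "F = (\<lambda>s. null_vec (f s) (g s) (h s))"
    and fgh: "f \<in> coordinate_algebra" "g \<in> coordinate_algebra" "h \<in> coordinate_algebra" by blast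
  obtain f' g' h' where "f' \<in> coordinate_algebra" "g' \<in> coordinate_algebra" "h' \<in> coordinate_algebra"
    "\<And>s. (f has_real_derivative f' s) (at s)" "\<And>s. (g has_real_derivative g' s) (at s)"
    "\<And>s. (h has_real_derivative h' s) (at s)"
    using fgh[THEN coordinate_algebra_DERIV] by blast
  then show "\<exists>G\<in>{\<lambda>s. null_vec (f s) (g s) (h s) | f g h.
    f \<in> coordinate_algebra \<and> g \<in> coordinate_algebra \<and> h \<in> coordinate_algebra}.
    \<forall>s. (F has_vector_derivative G s) (at s)"
    unfolding F by (intro bexI[of _ "\<lambda>s. null_vec (f' s) (g' s) (h' s)"])
      (auto intro!: has_vector_derivative_null_vec)
qed

text \<open>The half-plane velocity is (x', y') = -y (c, d), a vector of hyperbolic length 1; this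
  is its image in null coordinates.\<close>

lemma dot_gamma_p:
  "dot (gamma_p (l, e)) = (\<lambda>s. null_vec (- (2 * x s * c s) + (x s)^2 * b s * d s - y s * d s)
      (b s * d s) (- c s + x s * b s * d s))"
proof
  fix s
  have "(gamma_p (l, e) has_vector_derivative null_vec
      (2 * x s * (- (y s * c s)) * b s + (x s)^2 * (b s * d s) - y s * d s)
      (b s * d s) (- (y s * c s) * b s + x s * (b s * d s))) (at s)"
    unfolding gamma_p_eq
    by (rule has_vector_derivative_null_vec[OF _ DERIV_b])
      (auto intro!: derivative_eq_intros DERIVs simp: power2_eq_square algebra_simps)
  moreover have "2 * x s * (- (y s * c s)) * b s + (x s)^2 * (b s * d s) - y s * d s
      = - (2 * x s * c s) + (x s)^2 * b s * d s - y s * d s"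
    "- (y s * c s) * b s + x s * (b s * d s) = - c s + x s * b s * d s"
    using rel(1)[of s] by algebra+
  ultimately show "dot (gamma_p (l, e)) s = null_vec (- (2 * x s * c s) + (x s)^2 * b s * d s - y s * d s)
      (b s * d s) (- c s + x s * b s * d s)"
    by (simp only: dot_eqI)
qed

text \<open>The normal is the tangent after a quarter turn, that is, with (c, d) replaced by (-d,
  c).\<close>

lemma lcross_gamma_p:
  "gamma_p (l, e) s \<times>\<^sub>L dot (gamma_p (l, e)) s =
    null_vec ((x s)^2 * b s * c s - y s * c s + 2 * x s * d s) (b s * c s) (d s + x s * b s * c s)"
proof -
  define X Y B C D where "X = x s" and "Y = y s" and "B = b s" and "C = c s" and "D = d s"
  have r: "B * Y = 1" "C^2 + D^2 = 1" using rel[of s] by (simp_all add: Y_def B_def C_def D_def)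
  have "(X^2 * B + Y) * (- C + X * B * D) - X * B * (- (2 * X * C) + X^2 * B * D - Y * D)
      = X^2 * B * C - Y * C + 2 * X * D"
    using r by algebra
  moreover have "X * B * (B * D) - B * (- C + X * B * D) = B * C"
    by (simp add: algebra_simps)
  moreover have "((X^2 * B + Y) * (B * D) - B * (- (2 * X * C) + X^2 * B * D - Y * D)) / 2 = D + X * B * C"
    using r(1) by algebra
  ultimately show ?thesis
    unfolding dot_gamma_p unfolding gamma_p_eq null_vec_lcross X_def Y_def B_def C_def D_def by (simp only:)
qed

text \<open>The curvature is the rate of turning of the phase, corrected by the half-plane
  connection: \<phi>' - cos \<phi> = 2y(y + l) - (y^2 + 2ly) = y^2.\<close>

lemma dot_dot_gamma_p:
  "dot (dot (gamma_p (l, e))) s =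
    gamma_p (l, e) s + (y s)^2 *\<^sub>R (gamma_p (l, e) s \<times>\<^sub>L dot (gamma_p (l, e)) s)"
proof -
  define X Y B C D where "X = x s" and "Y = y s" and "B = b s" and "C = c s" and "D = d s"
  have r: "B * Y = 1" "C^2 + D^2 = 1" "Y^2 + 2 * l * Y = C"
    using rel[of s] by (simp_all add: Y_def B_def C_def D_def)
  let ?f = "2 * Y * (Y + l)"
  have "(dot (gamma_p (l, e)) has_vector_derivative null_vec
      (2 * Y * C * C + 2 * X * D * ?f + (- (2 * X * Y * C) * B * D + X^2 * (B * D) * D + X^2 * B * (C * ?f))
         + Y * D * D - Y * (C * ?f))
      (B * D * D + B * (C * ?f))
      (D * ?f - Y * C * B * D + X * (B * D) * D + X * B * (C * ?f))) (at s)"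
    unfolding dot_gamma_p X_def Y_def B_def C_def D_def
    by (rule has_vector_derivative_null_vec)
      (auto intro!: derivative_eq_intros DERIVs simp: power2_eq_square algebra_simps)
  moreover have
    "2 * Y * C * C + 2 * X * D * ?f + (- (2 * X * Y * C) * B * D + X^2 * (B * D) * D + X^2 * B * (C * ?f))
         + Y * D * D - Y * (C * ?f)
      = X^2 * B + Y + Y^2 * (X^2 * B * C - Y * C + 2 * X * D)"
    "B * D * D + B * (C * ?f) = B + Y^2 * (B * C)"
    "D * ?f - Y * C * B * D + X * (B * D) * D + X * B * (C * ?f) = X * B + Y^2 * (D + X * B * C)"
    using r by algebra+
  ultimately show ?thesis
    unfolding lcross_gamma_p unfolding gamma_p_eq null_vec_linear X_def Y_def B_def C_def D_def
    by (simp only: dot_eqI)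
qed

lemma hcurve_gamma_p: "hcurve (gamma_p (l, e))"
  unfolding hcurve_def hyperbolic_plane_def
proof (intro conjI allI smooth_gamma_p)
  fix s
  define X Y B C D where "X = x s" and "Y = y s" and "B = b s" and "C = c s" and "D = d s"
  have r: "B * Y = 1" "C^2 + D^2 = 1" using rel[of s] by (simp_all add: Y_def B_def C_def D_def)
  have "X * B * (X * B) - ((X^2 * B + Y) * B + B * (X^2 * B + Y)) / 2 = -1"
    "(- C + X * B * D) * (- C + X * B * D) -
      ((- (2 * X * C) + X^2 * B * D - Y * D) * (B * D) + B * D * (- (2 * X * C) + X^2 * B * D - Y * D)) / 2 = 1"
    using r by algebra+
  then have 1: "gamma_p (l, e) s \<bullet>\<^sub>L gamma_p (l, e) s = -1"
    and 2: "dot (gamma_p (l, e)) s \<bullet>\<^sub>L dot (gamma_p (l, e)) s = 1"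
    unfolding dot_gamma_p unfolding gamma_p_eq null_vec_lprod X_def Y_def B_def C_def D_def by simp_all
  have "b s > 0" using y_pos[of s] by (simp add: b_def)
  then have "gamma_p (l, e) s $ 1 > 0"
    using y_pos[of s] by (simp add: gamma_p_eq null_vec_def add_nonneg_pos add_pos_pos)
  with 1 show "gamma_p (l, e) s \<in> {x. x \<bullet>\<^sub>L x = -1 \<and> x$1 > 0}" by simp
  show "dot (gamma_p (l, e)) s \<bullet>\<^sub>L dot (gamma_p (l, e)) s = 1" by (fact 2)
qed

section \<open>Curvature, periodicity, momentum and modulus of the model curve\<close>

lemma curvature_gamma_p: "geodesic_curvature (gamma_p (l, e)) s = (y s)^2"
  by (rule geodesic_curvature_eqI[OF hcurve_gamma_p dot_dot_gamma_p])

lemma blaschke_gamma_p: "blaschke (gamma_p (l, e)) = y"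
  using y_pos by (auto simp: blaschke_def[abs_def] curvature_gamma_p less_imp_le)

lemma dot_y: "dot y s = - (y s * d s)"
  using DERIV_y by (intro dot_eqI) (simp add: has_real_derivative_iff_has_vector_derivative)

lemma surj_phase: "surj \<phi>"
  and phase_period: "\<exists>T>0. \<forall>s. \<phi> (s + T) = \<phi> s + 2 * pi"
proof -
  obtain \<psi> T where psi: "is_phase l \<psi>" "T > 0" "\<And>s. \<psi> (s + T) = \<psi> s + 2 * pi" "surj \<psi>"
    by (rule is_phase_exists[OF l_less]) (rule that)
  have "\<psi> = \<phi>"
    by (rule is_phase_unique[OF l_less psi(1) phase])
  with psi show "surj \<phi>" "\<exists>T>0. \<forall>s. \<phi> (s + T) = \<phi> s + 2 * pi" by auto
qed

lemma y_nonconstant: "\<not> y constant_on UNIV"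
proof -
  obtain s t where "0 = \<phi> s" "pi = \<phi> t"
    using surjD[OF surj_phase, of 0] surjD[OF surj_phase, of pi] by blast
  then have "y s \<noteq> y t" using y_eq[of s] y_eq[of t] by (simp add: mu_of_phase_def)
  then show ?thesis unfolding constant_on_def by force
qed

lemma periodic_y: "periodic y"
proof -
  obtain T where T: "T > 0" "\<And>s. \<phi> (s + T) = \<phi> s + 2 * pi"
    using phase_period by blast
  then have "periodic_fun_simple y T"
    by unfold_locales (simp add: y_eq mu_of_phase_def)
  with T(1) show ?thesis unfolding periodic_def by blast
qed

lemma B_curve_with_gamma_p: "B_curve_with l 0 (gamma_p (l, e))"
  unfolding B_curve_with_def blaschke_gamma_p
proof (intro conjI allI y_nonconstant periodic_y)
  show "convex_curve (gamma_p (l, e))"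
    using hcurve_gamma_p y_pos by (simp add: convex_curve_def curvature_gamma_p less_imp_neq[OF y_pos, symmetric])
  fix s
  show "y differentiable (at s)"
    using DERIV_y real_differentiable_def by blast
  have "Q l 0 (y s) = (c s)^2 - 1"
    unfolding rel(3)[symmetric] Q_def by algebra
  then have "Q l 0 (y s) = - ((d s)^2)"
    using rel(2)[of s] by simp
  then show "(dot y s)^2 = - ((y s)^2 * Q l 0 (y s))"
    by (simp add: dot_y power_mult_distrib)
qed

lemma has_momentum_gamma_p: "has_momentum (gamma_p (l, e)) ((1 / sqrt 2) *\<^sub>R vector [1, 0, 1])"
  unfolding has_momentum_def blaschke_gamma_p
proof (intro exI conjI allI)
  fix s
  define X Y B C D where "X = x s" and "Y = y s" and "B = b s" and "C = c s" and "D = d s"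
  have r: "B * Y = 1" "C^2 + D^2 = 1" "Y^2 + 2 * l * Y = C"
    using rel[of s] by (simp_all add: Y_def B_def C_def D_def)
  have coeff: "1 / (2 * y s) = B / 2" "dot y s / (2 * (y s)^2) = - (B * D) / 2"
    using y_pos[of s] by (simp_all add: dot_y B_def D_def b_def power2_eq_square)
  \<comment> \<open>The three null coordinates of the momentum expression; the claimed vector is
    \<open>null_vec 1 0 0\<close>.\<close>
  have "B / 2 * (X^2 * B + Y) + - (B * D) / 2 * (- (2 * X * C) + X^2 * B * D - Y * D)
      - (l + Y / 2) * (X^2 * B * C - Y * C + 2 * X * D) = 1"
    "B / 2 * B + - (B * D) / 2 * (B * D) - (l + Y / 2) * (B * C) = 0"
    "B / 2 * (X * B) + - (B * D) / 2 * (- C + X * B * D) - (l + Y / 2) * (D + X * B * C) = 0"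
    using r by algebra+
  moreover have "(1 / sqrt 2) *\<^sub>R vector [1, 0, 1] = null_vec 1 0 0"
    by (simp add: null_vec_def vec_eq_iff forall_3)
  ultimately show "(1 / sqrt 2) *\<^sub>R vector [1, 0, 1] =
      (1 / (2 * y s)) *\<^sub>R gamma_p (l, e) s
      + (dot y s / (2 * (y s)^2)) *\<^sub>R dot (gamma_p (l, e)) s
      - (l + y s / 2) *\<^sub>R (gamma_p (l, e) s \<times>\<^sub>L dot (gamma_p (l, e)) s)"
    unfolding coeff lcross_gamma_p unfolding dot_gamma_p unfolding gamma_p_eq null_vec_linear
    unfolding X_def Y_def B_def C_def D_def by (simp only:)
qed (fact B_curve_with_gamma_p)

lemma has_modulus_gamma_p: "has_modulus (gamma_p (l, e)) (l, e)"
proof -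
  have l2: "l^2 > 1" using l_less one_less_power[of "- l" 2] by simp
  \<comment> \<open>For c = 0 the roots satisfy (t + l)^2 = l^2 + 1 or (t + l)^2 = l^2 - 1. They are
    thus placed symmetrically about -l, and q < -l < p determines their signs.\<close>
  define p q where "p = sqrt (l^2 + 1)" and "q = sqrt (l^2 - 1)"
  have pq: "p^2 = l^2 + 1" "q^2 = l^2 - 1" "q > 0" "p > q" using l2 by (simp_all add: p_def q_def)
  have "p > - l" unfolding p_def by (rule real_less_rsqrt) simp
  moreover have "q < - l" using l_less l2 unfolding q_def by (intro real_less_lsqrt) auto
  moreover have "Q l 0 t = (t - (- l + p)) * (t - (- l + q)) * (t - (- l - q)) * (t - (- l - p))" for t
  proof -
    have "Q l 0 t = ((t + l)^2 - p^2) * ((t + l)^2 - q^2)"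
      unfolding pq Q_def by algebra
    then show ?thesis by algebra
  qed
  then have "{t. Q l 0 t = 0} = {- l + p, - l + q, - l - q, - l - p}" by auto
  moreover have "e = - l + q" using e_eq by (simp add: q_def)
  ultimately have "B_curve_with l 0 (gamma_p (l, e)) \<and> - l + p > e \<and> e > - l - q \<and> - l - q > 0 \<and>
      0 > - l - p \<and> {t. Q l 0 t = 0} = {- l + p, e, - l - q, - l - p}"
    using B_curve_with_gamma_p pq by simp
  then show ?thesis
    unfolding has_modulus_def split_conv by blast
qed

lemma BL_curve_gamma_p: "BL_curve (gamma_p (l, e))"
proof -
  have "light_like ((1 / sqrt 2) *\<^sub>R vector [1, 0, 1])"
    by (simp add: light_like_def lprod_def vec_eq_iff forall_3)
  then show ?thesis
    using has_momentum_gamma_p B_curve_with_gamma_p unfolding BL_curve_def B_curve_def by blast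
qed

end

section \<open>Non-existence of BL-strings\<close>

lemma continuous_periodic_attains_bounds:
  fixes f :: "real \<Rightarrow> real"
  assumes "periodic f" and cont: "\<And>s. isCont f s"
  obtains m M where "\<And>s. f m \<le> f s" "\<And>s. f s \<le> f M"
proof -
  obtain T where "T > 0" and "periodic_fun_simple f T"
    using assms(1) by (auto simp: periodic_def)
  interpret periodic_fun_simple f T by fact
  have reduce: "\<exists>t\<in>{0..T}. f s = f t" for s
  proof
    let ?n = "\<lfloor>s / T\<rfloor>"
    show "f s = f (s - of_int ?n * T)"
      by (rule minus_of_int[symmetric])
    show "s - of_int ?n * T \<in> {0..T}"
      using floor_divide_lower[OF \<open>T > 0\<close>, of s] floor_divide_upper[OF \<open>T > 0\<close>, of s]
      by (simp add: algebra_simps)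
  qed
  have on: "continuous_on {0..T} f"
    using cont by (simp add: continuous_at_imp_continuous_on)
  obtain m where m: "\<forall>t\<in>{0..T}. f m \<le> f t"
    using continuous_attains_inf[OF compact_Icc _ on] \<open>T > 0\<close> by auto
  obtain M where M: "\<forall>t\<in>{0..T}. f t \<le> f M"
    using continuous_attains_sup[OF compact_Icc _ on] \<open>T > 0\<close> by auto
  show ?thesis
  proof (rule that)
    show "f m \<le> f s" "f s \<le> f M" for s
      using reduce[of s] m M by auto
  qed
qed

text \<open>Gronwall in both directions: f^2 exp(-2Cs) does not increase and f^2 exp(2Cs) does not
  decrease, so a zero propagates forward by the first and backward by the second.\<close>

lemma linear_growth_imp_zero:
  fixes f :: "real \<Rightarrow> real"
  assumes d: "\<And>s. (f has_real_derivative f' s) (at s)" and bound: "\<And>s. \<bar>f' s\<bar> \<le> C * \<bar>f s\<bar>"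
    and "f a = 0"
  shows "f s = 0"
proof -
  have key: "2 * f t * f' t \<le> 2 * C * (f t)^2" "- (2 * C * (f t)^2) \<le> 2 * f t * f' t" for t
  proof -
    have "\<bar>2 * f t * f' t\<bar> \<le> 2 * \<bar>f t\<bar> * (C * \<bar>f t\<bar>)"
      using mult_left_mono[OF bound[of t], of "2 * \<bar>f t\<bar>"] by (simp add: abs_mult)
    also have "\<dots> = 2 * C * (\<bar>f t\<bar> * \<bar>f t\<bar>)" by (simp add: mult_ac)
    also have "\<dots> = 2 * C * (f t)^2" by (simp add: power2_eq_square)
    finally show "2 * f t * f' t \<le> 2 * C * (f t)^2" "- (2 * C * (f t)^2) \<le> 2 * f t * f' t"
      by (simp_all add: abs_le_iff)
  qed
  define g where "g k t = (f t)^2 * exp (k * t)" for k t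
  have deriv: "(g k has_real_derivative (2 * f t * f' t + k * (f t)^2) * exp (k * t)) (at t)" for k t
    unfolding g_def
    by (auto intro!: derivative_eq_intros d simp: algebra_simps power2_eq_square)
  have "\<exists>k. g k s \<le> g k a"
  proof (cases "a \<le> s")
    case True
    have "(2 * f t * f' t + - (2 * C) * (f t)^2) * exp (- (2 * C) * t) \<le> 0" for t
      using key(1)[of t] by (intro mult_nonpos_nonneg) auto
    then have "g (- (2 * C)) s \<le> g (- (2 * C)) a"
      using deriv by (intro DERIV_nonpos_imp_nonincreasing[OF True]) blast
    then show ?thesis ..
  next
    case False
    then have sa: "s \<le> a" by simp
    have "(2 * f t * f' t + 2 * C * (f t)^2) * exp (2 * C * t) \<ge> 0" for t
      using key(2)[of t] by (intro mult_nonneg_nonneg) auto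
    then have "g (2 * C) s \<le> g (2 * C) a"
      using deriv by (intro DERIV_nonneg_imp_nondecreasing[OF sa]) blast
    then show ?thesis ..
  qed
  then show ?thesis using \<open>f a = 0\<close> by (auto simp: g_def mult_le_0_iff)
qed

text \<open>The values at s - T/2 and s + T/2 coincide, so monotonicity makes f constant in
  between.\<close>

lemma periodic_antimono_imp_const:
  fixes f :: "real \<Rightarrow> real"
  assumes d: "\<And>s. (f has_real_derivative f' s) (at s)" "\<And>s. f' s \<le> 0"
    and per: "\<And>s. f (s + T) = f s" "T > 0"
  shows "f' s = 0"
proof -
  have mono: "f v \<le> f u" if "u \<le> v" for u v
    by (rule DERIV_nonpos_imp_nonincreasing[OF that]) (use d in blast)
  have "f s = f t" if "\<bar>s - t\<bar> < T / 2" for t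
  proof -
    have "s - T / 2 \<le> t" "t \<le> s + T / 2" "s - T / 2 \<le> s" "s \<le> s + T / 2"
      using that per(2) unfolding abs_less_iff by linarith+
    from this[THEN mono] show ?thesis
      using per(1)[of "s - T / 2"] by (simp add: add.commute)
  qed
  then show ?thesis
    using DERIV_local_const[OF d(1)[of s], of "T / 2"] per(2) by auto
qed

text \<open>Justifies the later division by \<mu> + l. Since (\<mu> + l)^2 = l^2 + w with w at least
  -1, only l^2 \<le> 1 is in doubt; there all critical values of \<mu> coincide, so maximum and
  minimum agree and \<mu> would be constant.\<close>

lemma mu_plus_l_nonzero:
  fixes \<mu> q :: "real \<Rightarrow> real"
  assumes pos: "\<And>s. \<mu> s > 0" and per: "periodic \<mu>" and nonconst: "\<not> \<mu> constant_on UNIV"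
    and d: "\<And>s. (\<mu> has_real_derivative q s) (at s)"
    and ode: "\<And>s. (q s)^2 = (\<mu> s)^2 * (1 - ((\<mu> s)^2 + 2 * l * \<mu> s)^2)"
  shows "\<mu> s + l \<noteq> 0"
proof -
  define w where "w s = (\<mu> s)^2 + 2 * l * \<mu> s" for s
  have sq: "(\<mu> s + l)^2 = l^2 + w s" for s
    by (simp add: w_def power2_eq_square algebra_simps)
  have w2: "(w s)^2 \<le> 1" for s
  proof -
    have "0 \<le> (\<mu> s)^2 * (1 - (w s)^2)"
      using ode[of s] unfolding w_def by (metis zero_le_power2)
    then show ?thesis using pos[of s] by (simp add: zero_le_mult_iff)
  qed
  then have w: "-1 \<le> w s" "w s \<le> 1" for s
    by (simp_all add: abs_square_le_1 abs_le_iff flip: abs_le_square_iff)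
  obtain m M where mM: "\<And>s. \<mu> m \<le> \<mu> s" "\<And>s. \<mu> s \<le> \<mu> M"
    using DERIV_isCont[OF d] by (rule continuous_periodic_attains_bounds[OF per]) (rule that)
  have "q m = 0" "q M = 0"
    using DERIV_local_min[OF d, of 1 m] DERIV_local_max[OF d, of 1 M] mM by auto
  show ?thesis
  proof (cases "l^2 > 1")
    case True
    then have "(\<mu> s + l)^2 > 0" unfolding sq using w[of s] by linarith
    then show ?thesis by auto
  next
    case False
    \<comment> \<open>At a critical point w is 1 or -1. The value -1 is excluded below; for w = 1,
      positivity of \<mu> rules out the negative root, as \<mu> + l < 0 would give (\<mu> + l)^2
      \<le> l^2.\<close>
    have crit: "\<mu> t = - l + sqrt (l^2 + 1)" if "q t = 0" for t
    proof -
      have "(w t)^2 = 1"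
        using ode[of t] pos[of t] that by (simp add: w_def)
      moreover have "w t \<noteq> -1"
      proof
        assume wt: "w t = -1"
        \<comment> \<open>Then \<open>l = -1\<close>, and \<open>\<mu> = 1\<close> is an equilibrium that no other solution reaches.\<close>
        then have "(\<mu> t + l)^2 = 0" "l^2 = 1"
          using sq[of t] False by (smt (verit) zero_le_power2)+
        then have mt: "\<mu> t = - l" and l: "l = -1"
          using pos[of t] by (auto simp: power2_eq_1_iff)
        \<comment> \<open>For l = -1 one has 1 + w = (\<mu> - 1)^2, so q^2 = \<mu>^2 (1 - w) (\<mu>
          - 1)^2. As \<mu> \<le> 3 and 1 - w \<le> 2, the first two factors contribute at most 18,
          below 5^2.\<close>
        have bound: "\<bar>q s\<bar> \<le> 5 * \<bar>\<mu> s - 1\<bar>" for s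
        proof (rule power2_le_imp_le)
          have ws: "(\<mu> s - 1)^2 = 1 + w s"
            using sq[of s] by (simp add: l)
          have "(\<mu> s - 1)^2 \<le> 2^2"
            using w[of s] ws by simp
          then have "\<mu> s \<le> 3"
            using power2_le_imp_le[of "\<mu> s - 1" 2] by simp
          then have "(\<mu> s)^2 \<le> 3^2"
            using pos[of s] by (intro power_mono) auto
          then have "(\<mu> s)^2 * (1 - w s) \<le> 9 * 2"
            using w[of s] by (intro mult_mono) auto
          then have "(\<mu> s)^2 * (1 - w s) * (\<mu> s - 1)^2 \<le> 25 * (\<mu> s - 1)^2"
            by (intro mult_right_mono) auto
          moreover have "(q s)^2 = (\<mu> s)^2 * (1 - w s) * (\<mu> s - 1)^2"
            unfolding ws ode w_def[symmetric] by (simp add: power2_eq_square algebra_simps)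
          ultimately show "\<bar>q s\<bar>^2 \<le> (5 * \<bar>\<mu> s - 1\<bar>)^2"
            by (simp add: power_mult_distrib)
        qed simp
        have deriv: "((\<lambda>s. \<mu> s - 1) has_real_derivative q s) (at s)" for s
          by (auto intro!: derivative_eq_intros d)
        have "\<mu> s - 1 = 0" for s
          using linear_growth_imp_zero[OF deriv bound, of t s] by (simp add: mt l)
        then have "\<mu> constant_on UNIV" unfolding constant_on_def by (intro exI[of _ 1]) simp
        then show False using nonconst by blast
      qed
      ultimately have "(\<mu> t + l)^2 = l^2 + 1"
        using sq[of t] by (simp add: power2_eq_1_iff)
      moreover have "\<mu> t + l \<ge> 0"
      proof (rule ccontr)
        assume neg: "\<not> \<mu> t + l \<ge> 0"
        then have "(\<mu> t + l)^2 \<le> l^2"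
          using pos[of t] abs_le_square_iff[of "\<mu> t + l" l] by auto
        then show False using calculation by simp
      qed
      ultimately show ?thesis
        using real_sqrt_unique[of "\<mu> t + l" "l^2 + 1"] by simp
    qed
    have "\<mu> s = \<mu> m" for s
      using mM[of s] crit[OF \<open>q m = 0\<close>] crit[OF \<open>q M = 0\<close>] by simp
    then have "\<mu> constant_on UNIV" unfolding constant_on_def by blast
    then show ?thesis using nonconst by blast
  qed
qed

text \<open>The products with the frame are the coefficients of \<xi>, with the sign reversed on the
  timelike vector \<gamma>. Expanding \<xi> . \<xi> = 0 then gives the first-order equation for
  \<mu> with c = 0.\<close>

lemma momentum_relations:
  assumes hc: "hcurve \<gamma>" and l: "light_like \<xi>"
    and \<xi>: "\<xi> = (1 / (2 * m)) *\<^sub>R \<gamma> s + (q / (2 * m^2)) *\<^sub>R dot \<gamma> s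
            - (l + m / 2) *\<^sub>R (\<gamma> s \<times>\<^sub>L dot \<gamma> s)"
    and m: "m > 0"
  shows "\<xi> \<bullet>\<^sub>L \<gamma> s = - 1 / (2 * m)" "\<xi> \<bullet>\<^sub>L dot \<gamma> s = q / (2 * m^2)"
    "\<xi> \<bullet>\<^sub>L (\<gamma> s \<times>\<^sub>L dot \<gamma> s) = - (l + m / 2)"
    "q^2 = m^2 * (1 - (m^2 + 2 * l * m)^2)"
proof -
  let ?n = "\<gamma> s \<times>\<^sub>L dot \<gamma> s"
  note fr = hcurve_frame[OF hc, of s]
  have sym: "dot \<gamma> s \<bullet>\<^sub>L \<gamma> s = 0" "?n \<bullet>\<^sub>L \<gamma> s = 0" "?n \<bullet>\<^sub>L dot \<gamma> s = 0"
    using fr lprod_lcross_left lprod_lcross_right by (simp_all add: lprod_commute)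
  have "\<gamma> s \<bullet>\<^sub>L \<xi> = - 1 / (2 * m)" "dot \<gamma> s \<bullet>\<^sub>L \<xi> = q / (2 * m^2)" "?n \<bullet>\<^sub>L \<xi> = - (l + m / 2)"
    unfolding \<xi> lprod_right_simps by (simp_all add: fr sym lprod_lcross_left lprod_lcross_right)
  then show 1: "\<xi> \<bullet>\<^sub>L \<gamma> s = - 1 / (2 * m)" and 2: "\<xi> \<bullet>\<^sub>L dot \<gamma> s = q / (2 * m^2)"
    and 3: "\<xi> \<bullet>\<^sub>L ?n = - (l + m / 2)"
    by (simp_all add: lprod_commute)
  have "0 = \<xi> \<bullet>\<^sub>L \<xi>" using l by (simp add: light_like_def)
  also have "\<dots> = \<xi> \<bullet>\<^sub>L ((1 / (2 * m)) *\<^sub>R \<gamma> s + (q / (2 * m^2)) *\<^sub>R dot \<gamma> s - (l + m / 2) *\<^sub>R ?n)"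
    using \<xi> by simp
  also have "\<dots> = - (1 / (4 * m^2)) + q^2 / (4 * m^4) + (l + m / 2)^2"
    unfolding lprod_right_simps 1 2 3 by (simp add: power2_eq_square power4_eq_xxxx algebra_simps)
  finally have "0 = 4 * m^4 * (- (1 / (4 * m^2)) + q^2 / (4 * m^4) + (l + m / 2)^2)" by simp
  also have "\<dots> = - (m^2) + q^2 + m^2 * (m^2 + 2 * l * m)^2"
    using m by (simp add: field_simps power2_eq_square power4_eq_xxxx)
  finally show "q^2 = m^2 * (1 - (m^2 + 2 * l * m)^2)" by (simp add: algebra_simps)
qed

text \<open>By Lagrange's identity the left side is the product of \<eta> x \<xi> with v x w. For
  \<eta> = (0, -\<xi>3, \<xi>2), which is orthogonal to \<xi>, light-likeness gives \<eta> x \<xi> =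
  \<xi>1 \<xi>, and \<xi>1 is non-zero.\<close>

lemma light_like_conjugate:
  assumes "light_like \<xi>"
  obtains \<eta> k where "k \<noteq> 0"
    "\<And>v w. (\<eta> \<bullet>\<^sub>L w) * (\<xi> \<bullet>\<^sub>L v) - (\<eta> \<bullet>\<^sub>L v) * (\<xi> \<bullet>\<^sub>L w) = k * (\<xi> \<bullet>\<^sub>L (v \<times>\<^sub>L w))"
proof
  have sq: "(\<xi>$1)^2 = (\<xi>$2)^2 + (\<xi>$3)^2" and nz: "\<xi> \<noteq> 0"
    using assms by (simp_all add: light_like_def lprod_def power2_eq_square)
  show "\<xi>$1 \<noteq> 0"
    using sq nz by (auto simp: vec_eq_iff forall_3 sum_power2_eq_zero_iff)
  show "(vector [0, - (\<xi>$3), \<xi>$2] \<bullet>\<^sub>L w) * (\<xi> \<bullet>\<^sub>L v) - (vector [0, - (\<xi>$3), \<xi>$2] \<bullet>\<^sub>L v) * (\<xi> \<bullet>\<^sub>L w)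
      = \<xi>$1 * (\<xi> \<bullet>\<^sub>L (v \<times>\<^sub>L w))" for v w :: "real^3"
    using sq by (simp add: lprod_def lcross_eq) algebra
qed

lemma periodic_dot:
  assumes "\<And>s. f (s + T) = f s" "\<And>s. (f has_vector_derivative dot f s) (at s)"
  shows "dot f (s + T) = dot f s"
proof -
  have "((\<lambda>s. s + T) has_vector_derivative 1) (at s)"
    by (auto intro!: derivative_eq_intros)
  from vector_diff_chain_at[OF this assms(2)]
  have "((\<lambda>s. f (s + T)) has_vector_derivative dot f (s + T)) (at s)"
    by (simp add: o_def)
  then show ?thesis
    unfolding assms(1) by (rule dot_eqI[symmetric])
qed

lemma no_BL_string: "\<not> BL_string \<gamma>"
proof
  assume "BL_string \<gamma>"
  then obtain l c \<xi> T where B: "B_curve_with l c \<gamma>" and light: "light_like \<xi>"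
    and mom: "\<And>s. \<xi> = (1 / (2 * blaschke \<gamma> s)) *\<^sub>R \<gamma> s
            + (dot (blaschke \<gamma>) s / (2 * (blaschke \<gamma> s)^2)) *\<^sub>R dot \<gamma> s
            - (l + blaschke \<gamma> s / 2) *\<^sub>R (\<gamma> s \<times>\<^sub>L dot \<gamma> s)"
    and T: "T > 0" and per: "periodic_fun_simple \<gamma> T"
    unfolding BL_string_def BL_curve_def has_momentum_def closed_curve_def periodic_def by blast
  define \<mu> where "\<mu> = blaschke \<gamma>"
  define q where "q = dot \<mu>"
  define n where "n s = \<gamma> s \<times>\<^sub>L dot \<gamma> s" for s
  have hc: "hcurve \<gamma>" and curv: "\<And>s. geodesic_curvature \<gamma> s > 0"
    and nonconst: "\<not> \<mu> constant_on UNIV" and permu: "periodic \<mu>"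
    and diff: "\<And>s. \<mu> differentiable (at s)"
    using B by (auto simp: B_curve_with_def convex_curve_def \<mu>_def)
  have pos: "\<mu> s > 0" for s
    using curv[of s] by (simp add: \<mu>_def blaschke_def)
  have kappa: "geodesic_curvature \<gamma> s = (\<mu> s)^2" for s
    using curv[of s] by (simp add: \<mu>_def blaschke_def)
  have dmu: "(\<mu> has_real_derivative q s) (at s)" for s
    using diff[of s] by (simp add: q_def dot_def has_real_derivative_iff_has_vector_derivative
        vector_derivative_works)
  note mr = momentum_relations[OF hc light mom[folded \<mu>_def, folded q_def] pos, folded n_def]
  have nz: "\<mu> s + l \<noteq> 0" for s
    using mu_plus_l_nonzero[OF pos permu nonconst dmu mr(4)] .
  have "smooth \<gamma>" using hc by (simp add: hcurve_def)
  note dg = smooth_has_vector_derivative[OF this]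
  have perg: "\<gamma> (s + T) = \<gamma> s" "dot \<gamma> (s + T) = dot \<gamma> s" for s
    using periodic_fun_simple.plus_period[OF per] periodic_dot[OF _ dg(1)] by blast+
  \<comment> \<open>By the momentum relations p = \<mu>' / (2\<mu>^2). Written as a product with the
    tangent it is visibly periodic, and differentiable by smoothness of \<gamma>, whereas
    \<open>B_curve_with\<close> asks for only one derivative of \<mu>.\<close>
  define p where "p s = \<xi> \<bullet>\<^sub>L dot \<gamma> s" for s
  have lprod_const: "((\<lambda>s. v \<bullet>\<^sub>L f s) has_real_derivative v \<bullet>\<^sub>L f') (at s)"
    if "(f has_vector_derivative f') (at s)" for v f f' s
    using has_real_derivative_lprod[OF has_vector_derivative_const that] by (simp add: lprod_def)
  have q: "q s = 2 * (\<mu> s)^2 * p s" for s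
    using mr(2)[of s] pos[of s] by (simp add: p_def)
  have dp: "(p has_real_derivative - (1 + (\<mu> s)^2 * ((\<mu> s)^2 + 2 * l * \<mu> s)) / (2 * \<mu> s)) (at s)" for s
  proof -
    have "\<xi> \<bullet>\<^sub>L dot (dot \<gamma>) s = - 1 / (2 * \<mu> s) + (\<mu> s)^2 * - (l + \<mu> s / 2)"
      by (simp add: frenet[OF hc] kappa lprod_right_simps mr(1) mr(3)[unfolded n_def])
    also have "\<dots> = - (1 + (\<mu> s)^2 * ((\<mu> s)^2 + 2 * l * \<mu> s)) / (2 * \<mu> s)"
      using pos[of s] by (simp add: field_simps power2_eq_square)
    finally show ?thesis
      using lprod_const[OF dg(2), of \<xi> s] unfolding p_def by simp
  qed
  obtain \<eta> k where k: "k \<noteq> 0"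
    and conj: "\<And>v w. (\<eta> \<bullet>\<^sub>L w) * (\<xi> \<bullet>\<^sub>L v) - (\<eta> \<bullet>\<^sub>L v) * (\<xi> \<bullet>\<^sub>L w) = k * (\<xi> \<bullet>\<^sub>L (v \<times>\<^sub>L w))"
    by (rule light_like_conjugate[OF light]) (rule that)
  \<comment> \<open>The factor -1/(2k) normalises the quotient so that its derivative is exactly
    \<mu> w.\<close>
  define H where "H s = - (\<eta> \<bullet>\<^sub>L \<gamma> s) / (\<xi> \<bullet>\<^sub>L \<gamma> s) / (2 * k)" for s
  have dH: "(H has_real_derivative \<mu> s * ((\<mu> s)^2 + 2 * l * \<mu> s)) (at s)" for s
  proof -
    have xg: "\<xi> \<bullet>\<^sub>L \<gamma> s \<noteq> 0" using mr(1)[of s] pos[of s] by simp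
    have "(H has_real_derivative
        - (((\<eta> \<bullet>\<^sub>L dot \<gamma> s) * (\<xi> \<bullet>\<^sub>L \<gamma> s) - (\<eta> \<bullet>\<^sub>L \<gamma> s) * (\<xi> \<bullet>\<^sub>L dot \<gamma> s)) / (\<xi> \<bullet>\<^sub>L \<gamma> s)^2 / (2 * k))) (at s)"
      unfolding H_def using xg k
      by (auto intro!: derivative_eq_intros lprod_const[OF dg(1)] simp: field_simps power2_eq_square)
    also have "- (((\<eta> \<bullet>\<^sub>L dot \<gamma> s) * (\<xi> \<bullet>\<^sub>L \<gamma> s) - (\<eta> \<bullet>\<^sub>L \<gamma> s) * (\<xi> \<bullet>\<^sub>L dot \<gamma> s)) / (\<xi> \<bullet>\<^sub>L \<gamma> s)^2 / (2 * k))
        = \<mu> s * ((\<mu> s)^2 + 2 * l * \<mu> s)"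
      unfolding conj mr(3)[unfolded n_def] unfolding mr(1) using k pos[of s]
      by (simp add: field_simps power2_eq_square)
    finally show ?thesis .
  qed
  \<comment> \<open>The added term equals \<mu>' / (2\<mu>(\<mu> + l)), expressed through p so that
    its derivative is available.\<close>
  define M where "M s = H s + p s * \<mu> s / (\<mu> s + l)" for s
  have dM: "(M has_real_derivative - ((q s)^2 / (2 * \<mu> s * (\<mu> s + l)^2))) (at s)" for s
  proof -
    define m w where "m = \<mu> s" and "w = (\<mu> s)^2 + 2 * l * \<mu> s"
    have m: "m > 0" "m + l \<noteq> 0" using pos[of s] nz[of s] by (simp_all add: m_def)
    have w: "w = m^2 + 2 * l * m" by (simp add: w_def m_def)
    have q2: "4 * m^2 * (p s)^2 = 1 - w^2"
      using mr(4)[of s] pos[of s] unfolding q w_def m_def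
      by (simp add: power_mult_distrib power2_eq_square mult_ac)
    have "(M has_real_derivative m * w
        + ((- (1 + m^2 * w) / (2 * m) * m + p s * q s) * (m + l) - p s * m * q s) / (m + l)^2) (at s)"
      unfolding M_def m_def w_def using nz[of s]
      by (auto intro!: derivative_eq_intros dH dp dmu simp: power2_eq_square algebra_simps)
    also have "(- (1 + m^2 * w) / (2 * m) * m + p s * q s) * (m + l) - p s * m * q s
        = (- ((1 + m^2 * w) * (m + l)) + l * (4 * m^2 * (p s)^2)) / 2"
      using m(1) unfolding q m_def[symmetric] by (simp add: field_simps power2_eq_square)
    also have "m * w + (- ((1 + m^2 * w) * (m + l)) + l * (4 * m^2 * (p s)^2)) / 2 / (m + l)^2
        = (2 * m * w * (m + l)^2 - (1 + m^2 * w) * (m + l) + l * (4 * m^2 * (p s)^2)) / (2 * (m + l)^2)"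
      using m(2) by (simp add: add_divide_distrib diff_divide_distrib)
    also have "2 * m * w * (m + l)^2 - (1 + m^2 * w) * (m + l) + l * (4 * m^2 * (p s)^2) = - (m * (1 - w^2))"
      unfolding q2 using w by algebra
    also have "- (m * (1 - w^2)) / (2 * (m + l)^2) = - ((q s)^2 / (2 * m * (m + l)^2))"
      using mr(4)[of s] m unfolding m_def[symmetric] w[symmetric]
      by (simp add: power2_eq_square)
    finally show ?thesis unfolding m_def .
  qed
  \<comment> \<open>The period of \<mu> from \<open>B_curve_with\<close> may differ from T. This
    formula shows that \<mu>, and with it M, inherits the period T of \<gamma>.\<close>
  have mu_eq: "\<mu> s = - 1 / (2 * (\<xi> \<bullet>\<^sub>L \<gamma> s))" for s
    unfolding mr(1) using pos[of s] by simp
  have "q s = 0" for s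
  proof -
    have "- ((q s)^2 / (2 * \<mu> s * (\<mu> s + l)^2)) = 0"
    proof (rule periodic_antimono_imp_const[OF dM _ _ T])
      show "- ((q s)^2 / (2 * \<mu> s * (\<mu> s + l)^2)) \<le> 0" for s
        using pos[of s] by simp
      show "M (s + T) = M s" for s
        unfolding M_def H_def p_def mu_eq perg ..
    qed
    then show ?thesis using pos[of s] nz[of s] by simp
  qed
  then have "(\<mu> has_real_derivative 0) (at s)" for s
    using dmu[of s] by simp
  then have "\<mu> s = \<mu> 0" for s
    by (rule DERIV_zero_imp_const)
  then have "\<mu> constant_on UNIV" unfolding constant_on_def by blast
  with nonconst show False by blast
qed

theorem theorem3p10:
  shows "(\<forall>p \<in> light_moduli.
            BL_curve (gamma_p p) \<and>
            has_modulus (gamma_p p) p \<and>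
            has_momentum (gamma_p p) ((1 / sqrt 2) *\<^sub>R vector [1, 0, 1])) \<and>
         \<not> (\<exists>\<gamma>. BL_string \<gamma>)"
proof (intro conjI ballI)
  fix p assume p: "p \<in> light_moduli"
  obtain l e where le: "p = (l, e)" by (cases p)
  then have "l < -1" using p by (simp add: light_moduli_iff)
  then obtain \<phi> where "is_phase l \<phi>"
    by (rule is_phase_exists)
  with p le interpret light_model l e \<phi>
    by unfold_locales simp_all
  show "BL_curve (gamma_p p)" "has_modulus (gamma_p p) p"
    "has_momentum (gamma_p p) ((1 / sqrt 2) *\<^sub>R vector [1, 0, 1])"
    unfolding le by (fact BL_curve_gamma_p has_modulus_gamma_p has_momentum_gamma_p)+
qed (use no_BL_string in blast)

end
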